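(* Let $d\ge3$, $m\ge1$, $\omega\in\Omega_{d,m}$, let $G_\omega$ be the corresponding spinal group with spinal generating set $S$, and let $\mu$ be the uniform Bernoulli measure on $X^{\mathbb{N}}$. Then all rooted, unlabeled isomorphism classes have measure zero in $X^{\mathbb{N}}$; that is, for every $\xi\in X^{\mathbb{N}}$ the set of all $\eta\in X^{\mathbb{N}}$ such that $(\Gamma_\eta,\eta)$ and $(\Gamma_\xi,\xi)$ are isomorphic as rooted, undirected, unlabeled graphs has $\mu$-measure zero.
   Context: Let $X=\{0,\dots,d-1\}$ with addition modulo $d$. $T_d$ is the $d$-ary rooted tree with vertex set $X^*$ (finite words); its boundary is $X^{\mathbb{N}}$ (infinite words), on which automorphisms of $T_d$ act via prefixes. Let $a(v_0v_1\dots)=(v_0+1)v_1\dots$ and $A=\langle a\rangle\cong\mathbb{Z}/d\mathbb{Z}$. Let $B=(\mathbb{Z}/d\mathbb{Z})^m$ and let $\operatorname{Epi}(B,A)$ be the set of surjective homomorphisms $B\to A$. $\Omega_{d,m}$ is the set of sequences $\omega=(\omega_n)_{n\ge0}$ in $\operatorname{Epi}(B,A)$ with $\bigcap_{j\ge i}\operatorname{Ker}(\omega_j)=1$ for all $i\ge0$. For $b\in B$, $b_\omega\in\operatorname{Aut}(T_d)$ sends a word of the form $(d-1)^r0v_{r+1}v_{r+2}\dots$ ($r\ge0$) to $(d-1)^r0\,\omega_r(b)(v_{r+1})\,v_{r+2}\dots$ and fixes all other words. The map $b\mapsto b_\omega$ is an injective homomorphism, and $B$ is identified with its image $B_\omega$.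 The spinal group is $G_\omega=\langle A,B_\omega\rangle$ and its spinal generating set is $S=(A\cup B_\omega)\setminus\{1\}$. The Schreier graph $\Gamma_\xi$ has as vertex set the orbit $G_\omega\cdot\xi$ and a directed edge labeled $s$ from $y$ to $s(y)$ for all $y\in G_\omega\cdot\xi$, $s\in S$. $(\Gamma,v)$ denotes $\Gamma$ rooted at $v$. As undirected, unlabeled graph one forgets orientations and labels of edges but keeps loops and multiple edges; isomorphisms of rooted graphs preserve the root. $\mu$ is the product of the uniform probability measures on $X$. *)

theory Defs
  imports
    "HOL-Probability.Probability"
    "HOL-Algebra.Bij"
    "HOL-Algebra.Product_Groups"
    "Graph_Theory.Digraph"
begin

section \<open>The rooted tree and its boundary\<close>

definition letters :: "nat \<Rightarrow> int set" where
  "letters d = {0..<int d}"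

abbreviation words :: "nat \<Rightarrow> int list set" where
  "words d \<equiv> lists (letters d)"

abbreviation tree_boundary :: "nat \<Rightarrow> (nat \<Rightarrow> int) set" where
  "tree_boundary d \<equiv> Pi UNIV (\<lambda>_. letters d)"

text \<open>
  The tree has root \<open>[]\<close> and an edge between \<open>u\<close> and \<open>u @ [x]\<close>.  As in \<^const>\<open>BijGroup\<close>,
  automorphisms are \<open>undefined\<close> outside \<open>words d\<close>, so that distinct functions are
  distinct automorphisms, and the product \<open>g \<otimes> h\<close> is \<open>g\<close> after \<open>h\<close>.
\<close>

definition tree_aut :: "nat \<Rightarrow> (int list \<Rightarrow> int list) monoid" where
  "tree_aut d = (BijGroup (words d))
     \<lparr>carrier := {g \<in> Bij (words d). g [] = [] \<and>
        (\<forall>u\<in>words d. \<forall>v\<in>words d. (\<exists>x. v = u @ [x]) \<longleftrightarrow> (\<exists>x. g v = g u @ [x]))}\<rparr>"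

text \<open>
  Automorphisms preserve prefixes, so the \<open>n\<close>-th letter of the image of an infinite word is
  the \<open>n\<close>-th letter of the image of its prefix of length \<open>n + 1\<close>.
\<close>

definition boundary_act :: "(int list \<Rightarrow> int list) \<Rightarrow> (nat \<Rightarrow> int) \<Rightarrow> (nat \<Rightarrow> int)" where
  "boundary_act g \<xi> = (\<lambda>n. g (map \<xi> [0..<Suc n]) ! n)"

definition bernoulli_measure :: "nat \<Rightarrow> (nat \<Rightarrow> int) measure" where
  "bernoulli_measure d = PiM UNIV (\<lambda>_. uniform_count_measure (letters d))"

section \<open>Spinal groups\<close>

definition rooted_gen :: "nat \<Rightarrow> int list \<Rightarrow> int list" where
  "rooted_gen d = (\<lambda>w\<in>words d. case w of [] \<Rightarrow> [] | x # u \<Rightarrow> ((x + 1) mod int d) # u)"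

definition group_A :: "nat \<Rightarrow> (int list \<Rightarrow> int list) monoid" where
  "group_A d = subgroup_generated (tree_aut d) {rooted_gen d}"

definition group_B :: "nat \<Rightarrow> nat \<Rightarrow> (nat \<Rightarrow> int) monoid" where
  "group_B d m = product_group {..<m} (\<lambda>_. integer_mod_group d)"

definition Omega :: "nat \<Rightarrow> nat \<Rightarrow> (nat \<Rightarrow> (nat \<Rightarrow> int) \<Rightarrow> (int list \<Rightarrow> int list)) set" where
  "Omega d m = {\<omega>. (\<forall>n. \<omega> n \<in> epi (group_B d m) (group_A d)) \<and>
     (\<forall>i. (\<Inter>j\<in>{i..}. kernel (group_B d m) (group_A d) (\<omega> j)) = {\<one>\<^bsub>group_B d m\<^esub>})}"

text \<open>
  Here \<open>r\<close> is the length of the longest prefix of \<open>w\<close> consisting of letters \<open>d - 1\<close>.  Elements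
  of \<^const>\<open>group_A\<close> only change the first letter of a word, so applying \<open>\<omega> r b\<close> to the whole
  remaining word changes only the letter following \<open>(d - 1)\<^sup>r 0\<close>.
\<close>

definition spinal_elt :: "nat \<Rightarrow> (nat \<Rightarrow> (nat \<Rightarrow> int) \<Rightarrow> (int list \<Rightarrow> int list)) \<Rightarrow>
    (nat \<Rightarrow> int) \<Rightarrow> int list \<Rightarrow> int list" where
  "spinal_elt d \<omega> b = (\<lambda>w\<in>words d.
     let r = length (takeWhile (\<lambda>x. x = int d - 1) w) in
     if r < length w \<and> w ! r = 0
     then take (Suc r) w @ \<omega> r b (drop (Suc r) w)
     else w)"

definition B_image :: "nat \<Rightarrow> nat \<Rightarrow> (nat \<Rightarrow> (nat \<Rightarrow> int) \<Rightarrow> (int list \<Rightarrow> int list)) \<Rightarrow>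
    (int list \<Rightarrow> int list) set" where
  "B_image d m \<omega> = spinal_elt d \<omega> ` carrier (group_B d m)"

definition spinal_group :: "nat \<Rightarrow> nat \<Rightarrow> (nat \<Rightarrow> (nat \<Rightarrow> int) \<Rightarrow> (int list \<Rightarrow> int list)) \<Rightarrow>
    (int list \<Rightarrow> int list) set" where
  "spinal_group d m \<omega> = generate (tree_aut d) (carrier (group_A d) \<union> B_image d m \<omega>)"

definition spinal_gens :: "nat \<Rightarrow> nat \<Rightarrow> (nat \<Rightarrow> (nat \<Rightarrow> int) \<Rightarrow> (int list \<Rightarrow> int list)) \<Rightarrow>
    (int list \<Rightarrow> int list) set" where
  "spinal_gens d m \<omega> = (carrier (group_A d) \<union> B_image d m \<omega>) - {\<one>\<^bsub>tree_aut d\<^esub>}"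

section \<open>Schreier graphs\<close>

text \<open>
  The arc \<open>(y, s)\<close> is the directed edge labeled \<open>s\<close> from \<open>y\<close> to \<open>s(y)\<close>.
\<close>

definition schreier_graph :: "nat \<Rightarrow> nat \<Rightarrow> (nat \<Rightarrow> (nat \<Rightarrow> int) \<Rightarrow> (int list \<Rightarrow> int list)) \<Rightarrow>
    (nat \<Rightarrow> int) \<Rightarrow> (nat \<Rightarrow> int, (nat \<Rightarrow> int) \<times> (int list \<Rightarrow> int list)) pre_digraph" where
  "schreier_graph d m \<omega> \<xi> =
     (let V = (\<lambda>g. boundary_act g \<xi>) ` spinal_group d m \<omega> in
      \<lparr>verts = V,
       arcs = V \<times> spinal_gens d m \<omega>,
       tail = fst,
       head = (\<lambda>(y, s). boundary_act s y)\<rparr>)"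

text \<open>
  Each arc counts as one undirected edge (a loop if its ends coincide); an isomorphism maps
  edges bijectively to edges and respects their unordered pairs of ends.
\<close>

definition rooted_undirected_iso ::
    "('v, 'e) pre_digraph \<Rightarrow> 'v \<Rightarrow> ('w, 'f) pre_digraph \<Rightarrow> 'w \<Rightarrow> bool" where
  "rooted_undirected_iso G u H v \<longleftrightarrow>
     (\<exists>\<phi> \<psi>. bij_betw \<phi> (verts G) (verts H) \<and> bij_betw \<psi> (arcs G) (arcs H) \<and>
        (\<forall>e\<in>arcs G. {tail H (\<psi> e), head H (\<psi> e)} = \<phi> ` {tail G e, head G e}) \<and>
        \<phi> u = v)"

end

(* Work with letters 0, ..., d-1.  Forgetting labels and multiplicities, the neighbours of y in a
   Schreier graph are obtained by changing the first letter, or the letter after (d-1)^r 0.  So the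
   graph is a union of copies of the finite level-n graphs, and a copy is left only through
   p = (d-1)^(n-1) 0, which leads to its sibling copies, and through q = (d-1)^n.  In a copy w1...
   the vertex q is a dead end, whereas in a copy w0... it leads further.  With R = 1 + dist(w, q),
   exchanging the copies 0 and 1 embeds the R-ball around w1... properly into the one around w0....
   Hence an isomorphism class, all of whose members have balls of the same sizes, cannot meet both
   of the cylinders w0 and w1, and its prefixes of length n number at most d (d-1)^(n-1).

   That the class is measurable at all follows by compactness: a rooted isomorphism exists iff
   isomorphisms exist on all balls, and on a ball this is a condition on finitely many
   equations u(eta) = v(eta) between words u, v in the generators. *)
theory Submission
  imports Defs
begin

section \<open>Balls in the Schreier graphs\<close>

text \<open>Only sizes of balls are compared, so no isomorphism has to be analysed for the
  separation: an injection of one ball onto a proper part of another finite ball is enough. Balls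
  see neither labels nor multiplicities, and since every \<omega>_r is onto A, the neighbours do not
  even depend on \<omega>. The letters 0 and 1 are chosen because a move past (d-1)^n needs the next
  letter to be 0 or d-1; for d \<ge> 3 the letter 1 is neither. The radius is the first at which the
  exit at q shows on the 0 side; on the 1 side the way round through p into another copy costs an
  extra step and is still invisible. The obstacle is measurability: a null set has to lie in the
  product sigma-algebra itself, so a bound by cylinders does not suffice. There multiplicities do
  matter, and isomorphisms have to be coded by data that do not refer to \<eta>; words in the
  generators name the vertices for this purpose.\<close>

lemma finite_letters: "finite (letters d)" and card_letters: "card (letters d) = d"
  by (simp_all add: letters_def)

lemma letters_nonempty: "d \<ge> 1 \<Longrightarrow> letters d \<noteq> {}"
  by (simp add: letters_def)

text \<open>These are the end points of walks of exactly \<open>k\<close> steps. They form a closed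
  ball because the neighbourhoods used later contain their centre on the boundary.\<close>

primrec nball :: "('v \<Rightarrow> 'v set) \<Rightarrow> nat \<Rightarrow> 'v \<Rightarrow> 'v set" where
  "nball N 0 y = {y}"
| "nball N (Suc k) y = (\<Union>z\<in>nball N k y. N z)"

lemma nball_add: "z \<in> nball N j y \<Longrightarrow> x \<in> nball N i z \<Longrightarrow> x \<in> nball N (j + i) y"
  by (induction i arbitrary: x) auto

lemma nball_mono:
  assumes refl: "\<And>z. z \<in> A \<Longrightarrow> z \<in> N z" and closed: "\<And>z. z \<in> A \<Longrightarrow> N z \<subseteq> A"
    and "y \<in> A" "k \<le> l"
  shows "nball N k y \<subseteq> nball N l y"
proof -
  have sub: "nball N k y \<subseteq> A" for k
    using \<open>y \<in> A\<close> closed by (induction k) auto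
  have "nball N k y \<subseteq> nball N (Suc k) y" for k
    using sub[of k] refl by auto
  then show ?thesis
    using \<open>k \<le> l\<close> by (rule lift_Suc_mono_le)
qed

lemma nball_mono_nbr:
  assumes "\<And>z. N z \<subseteq> M z" shows "nball N k y \<subseteq> nball M k y"
proof (induction k)
  case (Suc k)
  show ?case unfolding nball.simps by (rule UN_mono[OF Suc assms])
qed simp

text \<open>
  Two sequences are related by \<open>seq_nbr\<close> iff they are equal or adjacent in a Schreier graph, for
  any \<open>\<omega>\<close>; \<open>level_nbr d n\<close> only allows the moves that are visible on the first \<open>n\<close> letters.
\<close>

definition level_nbr :: "nat \<Rightarrow> nat \<Rightarrow> (nat \<Rightarrow> int) \<Rightarrow> (nat \<Rightarrow> int) set" where
  "level_nbr d n y = {y(0 := c) | c. c \<in> letters d} \<union>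
     {y(Suc r := c) | r c. Suc r < n \<and> c \<in> letters d \<and> (\<forall>i<r. y i = int d - 1) \<and> y r = 0}"

definition seq_nbr :: "nat \<Rightarrow> (nat \<Rightarrow> int) \<Rightarrow> (nat \<Rightarrow> int) set" where
  "seq_nbr d y = {y(0 := c) | c. c \<in> letters d} \<union>
     {y(Suc r := c) | r c. c \<in> letters d \<and> (\<forall>i<r. y i = int d - 1) \<and> y r = 0}"

lemma tree_boundary_upd: "y \<in> tree_boundary d \<Longrightarrow> c \<in> letters d \<Longrightarrow> y(i := c) \<in> tree_boundary d"
  by auto

lemma level_nbr_subset: "level_nbr d n y \<subseteq> seq_nbr d y"
  by (auto simp: level_nbr_def seq_nbr_def)

lemma level_nbr_mono: "n \<le> n' \<Longrightarrow> level_nbr d n y \<subseteq> level_nbr d n' y"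
  unfolding level_nbr_def using order_less_le_trans by blast

lemma seq_nbr_refl: "y \<in> tree_boundary d \<Longrightarrow> y \<in> seq_nbr d y"
proof -
  assume "y \<in> tree_boundary d"
  then have "y = y(0 := y 0)" "y 0 \<in> letters d" by auto
  then show ?thesis unfolding seq_nbr_def by blast
qed

lemma level_nbr_refl: "y \<in> tree_boundary d \<Longrightarrow> y \<in> level_nbr d n y"
proof -
  assume "y \<in> tree_boundary d"
  then have "y = y(0 := y 0)" "y 0 \<in> letters d" by auto
  then show ?thesis unfolding level_nbr_def by blast
qed

lemma seq_nbr_closed: "y \<in> tree_boundary d \<Longrightarrow> seq_nbr d y \<subseteq> tree_boundary d"
proof
  fix z assume "y \<in> tree_boundary d" "z \<in> seq_nbr d y"
  then show "z \<in> tree_boundary d"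
    unfolding seq_nbr_def using tree_boundary_upd[of y d] by blast
qed

lemma level_nbr_closed: "y \<in> tree_boundary d \<Longrightarrow> level_nbr d n y \<subseteq> tree_boundary d"
  by (rule order_trans[OF level_nbr_subset seq_nbr_closed])

lemma level_ball_mono:
  "y \<in> tree_boundary d \<Longrightarrow> k \<le> l \<Longrightarrow> nball (level_nbr d n) k y \<subseteq> nball (level_nbr d n) l y"
  by (rule nball_mono[OF level_nbr_refl level_nbr_closed])

lemma seq_ball_closed: "y \<in> tree_boundary d \<Longrightarrow> nball (seq_nbr d) k y \<subseteq> tree_boundary d"
proof (induction k)
  case (Suc k)
  show ?case unfolding nball.simps
    by (rule UN_least, rule seq_nbr_closed, rule subsetD[OF Suc.IH[OF Suc.prems]])
qed simp

text \<open>The letter changed by a move comes after the prefix that permits the move, so the same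
  move is available afterwards and restores the old letter.\<close>

lemma seq_nbr_sym:
  assumes "y \<in> tree_boundary d" "z \<in> seq_nbr d y" shows "y \<in> seq_nbr d z"
proof -
  consider c where "z = y(0 := c)" 
    | r c where "z = y(Suc r := c)" "\<forall>i<r. y i = int d - 1" "y r = 0"
    using assms(2) unfolding seq_nbr_def by blast
  then show ?thesis
  proof cases
    case 1
    then have "y = z(0 := y 0)" by auto
    then show ?thesis unfolding seq_nbr_def using assms(1) by blast
  next
    case 2
    then have "y = z(Suc r := y (Suc r))" "\<forall>i<r. z i = int d - 1" "z r = 0" by auto
    then show ?thesis unfolding seq_nbr_def using assms(1) by blast
  qed
qed

lemma finite_seq_nbr:
  assumes "d \<ge> 2" shows "finite (seq_nbr d y)"
proof (cases "\<exists>r. (\<forall>i<r. y i = int d - 1) \<and> y r = 0")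
  case True
  then obtain r where r: "\<forall>i<r. y i = int d - 1" "y r = 0" by blast
  \<comment> \<open>The permitting prefix is unique, since 0 differs from d-1 when d \<ge>
    2.\<close>
  have uniq: "r' = r" if "\<forall>i<r'. y i = int d - 1" "y r' = 0" for r'
    using that r \<open>d \<ge> 2\<close> by (cases r r' rule: linorder_cases) force+
  have "seq_nbr d y \<subseteq> (\<lambda>c. y(0 := c)) ` letters d \<union> (\<lambda>c. y(Suc r := c)) ` letters d"
    unfolding seq_nbr_def using uniq by fastforce
  then show ?thesis by (rule finite_subset) (simp add: finite_letters)
next
  case False
  then have "seq_nbr d y = (\<lambda>c. y(0 := c)) ` letters d"
    unfolding seq_nbr_def by blast
  then show ?thesis by (simp add: finite_letters)
qed

lemma finite_seq_ball: "d \<ge> 2 \<Longrightarrow> finite (nball (seq_nbr d) k y)"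
  by (induction k) (auto intro: finite_seq_nbr)

section \<open>Copies of the level-n graphs and the comparison of balls\<close>

text \<open>A level-(n+1) copy consists of d level-n copies joined at their points (d-1)^(n-1) 0:
  walk to that point, change letter \<open>n\<close> there, walk on in the new copy. The distance to
  \<open>q\<close> is finite for this reason.\<close>

lemma level_transitive:
  assumes "n \<ge> 1" "d \<ge> 2" "y \<in> tree_boundary d" "z \<in> tree_boundary d" "\<And>i. i \<ge> n \<Longrightarrow> z i = y i"
  shows "\<exists>k. z \<in> nball (level_nbr d n) k y"
  using assms(1,3-)
proof (induction n arbitrary: y z rule: dec_induct)
  case base
  then have "z = y(0 := z 0)" "z 0 \<in> letters d" by auto
  then have "z \<in> level_nbr d 1 y" unfolding level_nbr_def by blast
  then have "z \<in> nball (level_nbr d 1) 1 y" by simp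
  then show ?case by blast
next
  case (step n)
  have mono: "nball (level_nbr d n) k x \<subseteq> nball (level_nbr d (Suc n)) k x" for k x
    by (rule nball_mono_nbr, rule level_nbr_mono) simp
  define p where "p = (\<lambda>i. if i < n - 1 then int d - 1 else if i = n - 1 then 0 else y i)"
  have p: "p \<in> tree_boundary d" using step.prems(1) \<open>d \<ge> 2\<close> by (auto simp: p_def Pi_iff letters_def)
  have p': "p(n := z n) \<in> tree_boundary d" using tree_boundary_upd[OF p] step.prems(2) by blast
  have "p i = y i" if "i \<ge> n" for i using that \<open>1 \<le> n\<close> by (auto simp: p_def)
  from step.IH[OF step.prems(1) p this] obtain k where "p \<in> nball (level_nbr d n) k y"
    by blast
  then have 1: "p \<in> nball (level_nbr d (Suc n)) k y"
    using mono by blast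
  have "p(Suc (n - 1) := z n) \<in> level_nbr d (Suc n) p"
    unfolding level_nbr_def using step.prems(2) \<open>1 \<le> n\<close>
    by (intro UnI2 CollectI exI[of _ "n - 1"] exI[of _ "z n"]) (auto simp: p_def)
  then have 2: "p(n := z n) \<in> nball (level_nbr d (Suc n)) (Suc 0) p"
    using \<open>1 \<le> n\<close> by simp
  have "z i = (p(n := z n)) i" if "i \<ge> n" for i
    using that step.prems(3)[of i] \<open>1 \<le> n\<close> by (auto simp: p_def)
  from step.IH[OF p' step.prems(2) this] obtain l where "z \<in> nball (level_nbr d n) l (p(n := z n))"
    by blast
  then have 3: "z \<in> nball (level_nbr d (Suc n)) l (p(n := z n))"
    using mono by blast
  show ?case
    using nball_add[OF nball_add[OF 1 2] 3] by blast
qed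

text \<open>A move among the first \<open>n\<close> letters neither reads nor changes later ones, so
  it can be replayed over any other tail.\<close>

lemma level_nbr_transfer:
  assumes "n \<ge> 1" "z \<in> tree_boundary d" "x \<in> level_nbr d n z"
    and eq: "\<And>i. i < n \<Longrightarrow> z' i = z i" and eqx: "\<And>i. x' i = (if i < n then x i else z' i)"
  shows "x' \<in> level_nbr d n z'"
proof -
  consider c where "c \<in> letters d" "x = z(0 := c)" 
    | r c where "Suc r < n" "c \<in> letters d" "x = z(Suc r := c)" "\<forall>i<r. z i = int d - 1" "z r = 0"
    using assms(3) unfolding level_nbr_def by blast
  then show ?thesis
  proof cases
    case 1
    then have "x' = z'(0 := c)" using eqx eq \<open>n \<ge> 1\<close> by auto
    then show ?thesis unfolding level_nbr_def using 1 by blast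
  next
    case 2
    then have "x' = z'(Suc r := c)" "\<forall>i<r. z' i = int d - 1" "z' r = 0"
      using eqx eq \<open>n \<ge> 1\<close> by auto
    then show ?thesis unfolding level_nbr_def using 2 by blast
  qed
qed

lemma level_nbr_ge:
  assumes "n \<ge> 1" "x \<in> level_nbr d n z" "i \<ge> n" shows "x i = z i"
  using assms unfolding level_nbr_def by auto

lemma card_ball_less:
  assumes "d \<ge> 3" "n \<ge> 1" and y: "y \<in> tree_boundary d" "y' \<in> tree_boundary d"
    and eq: "\<And>i. i < n \<Longrightarrow> y' i = y i" and "y n = 1" "y' n = 0"
  shows "\<exists>R. card (nball (seq_nbr d) R y) < card (nball (seq_nbr d) R y')"
proof -
  let ?L = "nball (level_nbr d n)" and ?B = "nball (seq_nbr d)"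
  \<comment> \<open>\<open>p\<close> and \<open>q\<close> are the only vertices through which one leaves the level-\<open>n\<close> copy around \<open>y\<close>:
    \<open>p\<close> leads to the sibling copies, \<open>q\<close> is a dead end for \<open>y n = 1\<close> but leads further for
    \<open>y' n = 0\<close>.  The map \<open>\<Phi>\<close> interchanges the copies \<open>0\<close> and \<open>1\<close> and compares balls.\<close>
  define q where "q = (\<lambda>i. if i < n then int d - 1 else y i)"
  define p where "p = (\<lambda>i. if i < n - 1 then int d - 1 else if i = n - 1 then 0 else y i)"
  have q: "q \<in> tree_boundary d" and p: "p \<in> tree_boundary d"
    using y \<open>d \<ge> 3\<close> by (auto simp: q_def p_def Pi_iff letters_def)
  define \<sigma> :: "int \<Rightarrow> int" where "\<sigma> = (\<lambda>x. if x = 0 then 1 else if x = 1 then 0 else x)"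
  have \<sigma>_inj: "\<sigma> x = \<sigma> x' \<longleftrightarrow> x = x'" for x x' by (auto simp: \<sigma>_def)
  have \<sigma>_mem: "\<sigma> x \<in> letters d" if "x \<in> letters d" for x
    using that \<open>d \<ge> 3\<close> by (auto simp: \<sigma>_def letters_def)
  \<comment> \<open>Beyond \<open>n\<close> the tail of \<open>y'\<close> is inserted, as
    \<open>y\<close> and \<open>y'\<close> need not agree there. Nothing is lost on the ball of
    \<open>y\<close>, whose points all carry the tail of \<open>y\<close> beyond
    \<open>n\<close>.\<close>
  define \<Phi> where "\<Phi> = (\<lambda>z i. if i < n then z i else if i = n then \<sigma> (z n) else y' i)"
  define K where "K = (LEAST k. q \<in> ?L k y)"
  have "\<exists>k. q \<in> ?L k y"
    by (rule level_transitive) (use assms q in \<open>auto simp: q_def\<close>)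
  then have qK: "q \<in> ?L K y" unfolding K_def by (rule LeastI_ex)
  have K_le: "K \<le> k" if "q \<in> ?L k y" for k
    unfolding K_def using that by (rule Least_le)
  have \<Phi>y: "\<Phi> y = y'"
    using eq \<open>y n = 1\<close> \<open>y' n = 0\<close> by (auto simp: \<Phi>_def \<sigma>_def fun_eq_iff)
  \<comment> \<open>The invariant records the cost of a walk. A point in the copy of
    \<open>y\<close> is reached by level-\<open>n\<close> moves alone; any other point has required
    a walk to \<open>p\<close>, one step into a sibling copy, and further level-\<open>n\<close>
    moves. Setting letter \<open>n\<close> to 1 folds the siblings onto the copy of
    \<open>y\<close>, so that those moves too are measured there.\<close>
  have inv: "z \<in> tree_boundary d \<and> (\<forall>i>n. z i = y i) \<and> \<Phi> z \<in> ?B k y' \<and>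
      (if z n = 1 then z \<in> ?L k y else \<exists>i j. p \<in> ?L i y \<and> z(n := 1) \<in> ?L j p \<and> i + 1 + j \<le> k)"
    if "z \<in> ?B k y" "k \<le> Suc K" for z k
    using that
  proof (induction k arbitrary: z)
    case 0
    then show ?case using \<Phi>y \<open>y n = 1\<close> y by auto
  next
    case (Suc k)
    from Suc.prems obtain x where x: "x \<in> ?B k y" and z: "z \<in> seq_nbr d x" by auto
    from Suc.IH[OF x] Suc.prems
    have xb: "x \<in> tree_boundary d" and tail: "\<And>i. i > n \<Longrightarrow> x i = y i" and \<Phi>x: "\<Phi> x \<in> ?B k y'"
      and pos: "if x n = 1 then x \<in> ?L k y
        else \<exists>i j. p \<in> ?L i y \<and> x(n := 1) \<in> ?L j p \<and> i + 1 + j \<le> k" by auto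
    have zb: "z \<in> tree_boundary d" using xb z seq_nbr_closed by blast
    have \<Phi>z: "\<Phi> z \<in> ?B (Suc k) y'" if "\<Phi> z \<in> seq_nbr d (\<Phi> x)"
      using \<Phi>x that by auto
    \<comment> \<open>A move that touches only letters before \<open>n\<close> remains such a move
      after \<open>\<Phi>\<close> and after folding.\<close>
    have L: "z \<in> level_nbr d n x \<Longrightarrow> ?case"
    proof -
      assume l: "z \<in> level_nbr d n x"
      have ge: "z i = x i" if "i \<ge> n" for i by (rule level_nbr_ge[OF \<open>n \<ge> 1\<close> l that])
      have "\<Phi> z \<in> level_nbr d n (\<Phi> x)"
        by (rule level_nbr_transfer[OF \<open>n \<ge> 1\<close> xb l]) (use ge in \<open>auto simp: \<Phi>_def\<close>)
      then have 1: "\<Phi> z \<in> ?B (Suc k) y'" using \<Phi>z level_nbr_subset by blast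
      have 2: "z(n := 1) \<in> level_nbr d n (x(n := 1))"
        by (rule level_nbr_transfer[OF \<open>n \<ge> 1\<close> xb l]) (use ge in auto)
      have 3: "z \<in> ?L (Suc k) y" if "x n = 1" using pos that l by auto
      have 4: "\<exists>i j. p \<in> ?L i y \<and> z(n := 1) \<in> ?L j p \<and> i + 1 + j \<le> Suc k" if "x n \<noteq> 1"
      proof -
        from pos that obtain i j where "p \<in> ?L i y" "x(n := 1) \<in> ?L j p" "i + 1 + j \<le> k" by auto
        then have "p \<in> ?L i y \<and> z(n := 1) \<in> ?L (Suc j) p \<and> i + 1 + Suc j \<le> Suc k"
          using 2 by auto
        then show ?thesis by blast
      qed
      show ?case using zb ge tail 1 3 4 by auto
    qed
    consider c where "c \<in> letters d" "z = x(0 := c)" 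
    | r c where "c \<in> letters d" "z = x(Suc r := c)" "\<forall>i<r. x i = int d - 1" "x r = 0"
      using z unfolding seq_nbr_def by blast
    then show ?case
    proof cases
      case 1
      then show ?thesis by (intro L) (auto simp: level_nbr_def)
    next
      case 2
      consider "Suc r < n" | "Suc r = n" | "r \<ge> n" by linarith
      then show ?thesis
      proof cases
        case a: 1
        show ?thesis by (rule L) (use 2 a in \<open>auto simp: level_nbr_def\<close>)
      next
        case b: 2
        \<comment> \<open>Changing letter \<open>n\<close> demands (d-1)^(n-1) 0 in front, so
          \<open>x\<close> and \<open>z\<close> both fold to \<open>p\<close>. A step with
          \<open>c = 1\<close> lands on \<open>p\<close> itself; any other starts an excursion with
          \<open>j = 0\<close>.\<close>
        have xp: "x(n := 1) = p"
          using 2 b tail \<open>y n = 1\<close> by (auto simp: p_def fun_eq_iff)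
        have zp: "z(n := 1) = p" "z n = c" using 2 b xp by auto
        have "\<Phi> z = (\<Phi> x)(Suc r := \<sigma> c)" using 2 b by (auto simp: \<Phi>_def fun_eq_iff)
        moreover have "\<sigma> c \<in> letters d" "\<forall>i<r. \<Phi> x i = int d - 1" "\<Phi> x r = 0"
          using 2 b \<sigma>_mem by (auto simp: \<Phi>_def)
        ultimately have "\<Phi> z \<in> seq_nbr d (\<Phi> x)"
          unfolding seq_nbr_def by blast
        then have 1: "\<Phi> z \<in> ?B (Suc k) y'" by (rule \<Phi>z)
        obtain i where i: "i \<le> k" "p \<in> ?L i y"
        proof (cases "x n = 1")
          case True
          then have "x = p" using xp by auto
          with pos True that show ?thesis by auto
        next
          case False
          with pos obtain i j where "p \<in> ?L i y" "i + 1 + j \<le> k" by auto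
          then show ?thesis by (intro that[of i]) auto
        qed
        have "p \<in> ?L (Suc k) y"
          using i level_ball_mono[OF y(1), of i "Suc k" n] by auto
        moreover have "p \<in> ?L i y \<and> z(n := 1) \<in> ?L 0 p \<and> i + 1 + 0 \<le> Suc k"
          using i zp by auto
        moreover have "z = p" if "z n = 1" using that zp by auto
        moreover have "\<forall>i>n. z i = y i" using 2 b tail by auto
        ultimately show ?thesis using zb 1 by (metis (no_types, lifting))
      next
        case c: 3
        \<comment> \<open>Leaving the level-\<open>n\<close> copies needs a visit to \<open>p\<close>, one step to another copy and a
          walk to the copy of \<open>q\<close>, which takes too long.\<close>
        have "x n \<noteq> 1" using 2 c \<open>d \<ge> 3\<close> by (cases "r = n") auto
        moreover have "x(n := 1) = q"
          using 2 c tail \<open>y n = 1\<close> \<open>d \<ge> 3\<close> by (auto simp: q_def fun_eq_iff)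
        ultimately obtain i j where ij: "p \<in> ?L i y" "q \<in> ?L j p" "i + 1 + j \<le> k"
          using pos by auto
        have "K \<le> i + j" by (rule K_le) (rule nball_add[OF ij(1,2)])
        with ij Suc.prems show ?thesis by linarith
      qed
    qed
  qed
  have sub: "\<Phi> ` ?B (Suc K) y \<subseteq> ?B (Suc K) y'" using inv by blast
  have inj: "inj_on \<Phi> (?B (Suc K) y)"
  proof (rule inj_onI, rule ext)
    fix z z' i assume "z \<in> ?B (Suc K) y" "z' \<in> ?B (Suc K) y" and e: "\<Phi> z = \<Phi> z'"
    then have "\<forall>i>n. z i = z' i" using inv[OF _ order_refl] by metis
    moreover have "\<Phi> z i = \<Phi> z' i" using e by simp
    ultimately show "z i = z' i"
      by (cases i n rule: linorder_cases) (auto simp: \<Phi>_def \<sigma>_inj)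
  qed
  have "?L K y \<subseteq> ?B K y" by (rule nball_mono_nbr) (rule level_nbr_subset)
  then have "q \<in> ?B K y" using qK by blast
  then have \<Phi>q: "\<Phi> q \<in> ?B K y'" using inv by auto
  \<comment> \<open>Any letter other than that of \<open>y'\<close> at position n+1 would do: all
    values of \<open>\<Phi>\<close> carry the tail of \<open>y'\<close>, so a point with
    \<open>c\<close> there escapes the image of the ball.\<close>
  define c where "c = (if y' (Suc n) = 0 then 1 else 0 :: int)"
  have c: "c \<noteq> y' (Suc n)" "c \<in> letters d" using \<open>d \<ge> 3\<close> by (auto simp: c_def letters_def)
  have "\<forall>i<n. \<Phi> q i = int d - 1" "\<Phi> q n = 0"
    using \<open>y n = 1\<close> by (auto simp: \<Phi>_def \<sigma>_def q_def)
  then have "(\<Phi> q)(Suc n := c) \<in> seq_nbr d (\<Phi> q)"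
    unfolding seq_nbr_def using c by blast
  then have new: "(\<Phi> q)(Suc n := c) \<in> ?B (Suc K) y'" using \<Phi>q by auto
  have "(\<Phi> q)(Suc n := c) \<notin> \<Phi> ` ?B (Suc K) y"
  proof
    assume "(\<Phi> q)(Suc n := c) \<in> \<Phi> ` ?B (Suc K) y"
    then obtain z where "(\<Phi> q)(Suc n := c) = \<Phi> z" by blast
    then have "((\<Phi> q)(Suc n := c)) (Suc n) = \<Phi> z (Suc n)" by simp
    then show False using c by (simp add: \<Phi>_def)
  qed
  then have "\<Phi> ` ?B (Suc K) y \<subset> ?B (Suc K) y'" using sub new by blast
  moreover have "finite (?B (Suc K) y')"
    using \<open>d \<ge> 3\<close> by (intro finite_seq_ball) simp
  ultimately have "card (\<Phi> ` ?B (Suc K) y) < card (?B (Suc K) y')"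
    by (rule psubset_card_mono[rotated])
  then show ?thesis unfolding card_image[OF inj] by blast
qed

section \<open>Compactness\<close>

text \<open>Diagonal argument in a product of finite sets: the pigeonhole principle gives nested
  infinite index sets, each making \<open>f\<close> constant at one more point of an enumeration of
  \<open>W\<close>. A finite \<open>U\<close> is handled by a single one of them, whose infinitude
  provides indices beyond any \<open>n\<close>.\<close>

lemma limit_of_finite_choices:
  fixes f :: "nat \<Rightarrow> 'a \<Rightarrow> 'b"
  assumes "countable W" and fin: "\<And>u. u \<in> W \<Longrightarrow> finite (F u)"
    and f: "\<And>R u. u \<in> W \<Longrightarrow> f R u \<in> F u"
  shows "\<exists>g. \<forall>U n. finite U \<longrightarrow> U \<subseteq> W \<longrightarrow> (\<exists>R\<ge>n. \<forall>u\<in>U. f R u = g u)"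
proof (cases "W = {}")
  case True
  then show ?thesis by auto
next
  case False
  define e where "e = from_nat_into W"
  have e: "range e = W"
    unfolding e_def using range_from_nat_into[OF False \<open>countable W\<close>] .
  have "\<exists>I :: nat \<Rightarrow> nat set. \<forall>n. infinite (I n) \<and> I (Suc n) \<subseteq> I n \<and> (\<exists>c. \<forall>R\<in>I (Suc n). f R (e n) = c)"
  proof -
    have step: "\<exists>J. infinite J \<and> J \<subseteq> I \<and> (\<exists>c. \<forall>R\<in>J. f R (e n) = c)" if "infinite I" for I :: "nat set" and n
    proof -
      have "e n \<in> W" using e by blast
      then have "finite ((\<lambda>R. f R (e n)) ` I)"
        using fin f by (meson finite_subset image_subsetI)
      from pigeonhole_infinite[OF \<open>infinite I\<close> this] obtain R0
        where "infinite {R \<in> I. f R (e n) = f R0 (e n)}" by blast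
      then show ?thesis by (intro exI[of _ "{R \<in> I. f R (e n) = f R0 (e n)}"]) auto
    qed
    have "\<exists>I :: nat \<Rightarrow> nat set. \<forall>n. infinite (I n) \<and> (I (Suc n) \<subseteq> I n \<and> (\<exists>c. \<forall>R\<in>I (Suc n). f R (e n) = c))"
      by (rule dependent_nat_choice) (use step in \<open>auto intro: infinite_UNIV_nat\<close>)
    then show ?thesis by simp
  qed
  then obtain I :: "nat \<Rightarrow> nat set" and c where inf: "\<And>n. infinite (I n)"
    and sub: "\<And>n. I (Suc n) \<subseteq> I n" and c: "\<And>n R. R \<in> I (Suc n) \<Longrightarrow> f R (e n) = c n"
    by metis
  have anti: "I m \<subseteq> I n" if "n \<le> m" for n m
    by (rule lift_Suc_antimono_le[where f = I, OF sub that])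
  \<comment> \<open>The enumeration may repeat points, so one index is fixed for each
    \<open>u\<close>; \<open>k\<close> below is the same choice.\<close>
  define g where "g u = c (SOME n. e n = u)" for u
  have "\<exists>R\<ge>n. \<forall>u\<in>U. f R u = g u" if U: "finite U" "U \<subseteq> W" for U n
  proof -
    define k where "k u = (SOME n. e n = u)" for u
    have k: "e (k u) = u" if "u \<in> U" for u
      unfolding k_def by (rule someI_ex) (use that U e in blast)
    define N where "N = Suc (Max (insert 0 (k ` U)))"
    have kN: "Suc (k u) \<le> N" if "u \<in> U" for u
      unfolding N_def using U that by (simp add: Max_ge)
    obtain R where R: "R \<ge> n" "R \<in> I N"
      using inf[of N] by (metis finite_nat_set_iff_bounded_le nat_le_linear)
    have "f R u = g u" if "u \<in> U" for u
      using c[of R "k u"] anti[OF kN[OF that]] R k[OF that] by (auto simp: g_def k_def)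
    then show ?thesis using R by blast
  qed
  then show ?thesis by blast
qed

section \<open>Graphs and their edge multiplicities\<close>

text \<open>Supplies the bijection of edges: the fibres will be the sets of edges with given ends,
  and bijections between fibres of equal finite size are glued together.\<close>

lemma bij_betw_fibres:
  assumes t: "\<And>e. e \<in> A \<Longrightarrow> t e \<in> P" and t': "\<And>f. f \<in> B \<Longrightarrow> t' f \<in> Q"
    and F: "bij_betw F P Q"
    and fin: "\<And>p. p \<in> P \<Longrightarrow> finite {e \<in> A. t e = p}" "\<And>q. q \<in> Q \<Longrightarrow> finite {f \<in> B. t' f = q}"
    and card: "\<And>p. p \<in> P \<Longrightarrow> card {e \<in> A. t e = p} = card {f \<in> B. t' f = F p}"
  shows "\<exists>\<psi>. bij_betw \<psi> A B \<and> (\<forall>e\<in>A. t' (\<psi> e) = F (t e))"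
proof -
  have "\<exists>h. bij_betw h {e \<in> A. t e = p} {f \<in> B. t' f = F p}" if "p \<in> P" for p
    using that F by (intro finite_same_card_bij fin card) (auto dest: bij_betwE)
  then obtain h where h: "\<And>p. p \<in> P \<Longrightarrow> bij_betw (h p) {e \<in> A. t e = p} {f \<in> B. t' f = F p}"
    by metis
  define \<psi> where "\<psi> e = h (t e) e" for e
  have \<psi>: "\<psi> e \<in> B" "t' (\<psi> e) = F (t e)" if "e \<in> A" for e
    using bij_betwE[OF h[OF t[OF that]]] that by (auto simp: \<psi>_def)
  have "bij_betw \<psi> A B"
  proof (rule bij_betwI')
    fix e e' assume e: "e \<in> A" "e' \<in> A"
    show "\<psi> e = \<psi> e' \<longleftrightarrow> e = e'"
    proof
      assume eq: "\<psi> e = \<psi> e'"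
      then have "F (t e) = F (t e')" using \<psi> e by metis
      then have "t e = t e'"
        using F t e by (auto simp: bij_betw_def dest: inj_onD)
      then show "e = e'"
        using eq h[OF t[OF e(1)]] e by (auto simp: \<psi>_def bij_betw_def dest: inj_onD)
    qed simp
  next
    fix f assume f: "f \<in> B"
    then obtain p where p: "p \<in> P" "t' f = F p"
      using t' F by (metis bij_betw_imp_surj_on imageE)
    then have "f \<in> h p ` {e \<in> A. t e = p}"
      using h[OF p(1)] f by (simp add: bij_betw_def)
    then show "\<exists>e\<in>A. f = \<psi> e" by (auto simp: \<psi>_def)
  qed (use \<psi> in auto)
  then show ?thesis using \<psi> by blast
qed

text \<open>Converse of the gluing: injectivity of \<open>F\<close> on \<open>P\<close> makes
  \<open>\<psi>\<close> map the fibre over \<open>p\<close> onto the whole fibre over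
  \<open>F p\<close>.\<close>

lemma card_fibres_bij_betw:
  assumes "bij_betw \<psi> A B" and \<psi>: "\<And>e. e \<in> A \<Longrightarrow> t' (\<psi> e) = F (t e)"
    and "inj_on F P" and t: "\<And>e. e \<in> A \<Longrightarrow> t e \<in> P" and "p \<in> P"
  shows "card {f \<in> B. t' f = F p} = card {e \<in> A. t e = p}"
proof -
  have "{f \<in> B. t' f = F p} = \<psi> ` {e \<in> A. t e = p}"
  proof
    show "\<psi> ` {e \<in> A. t e = p} \<subseteq> {f \<in> B. t' f = F p}"
      using \<psi> bij_betwE[OF assms(1)] by auto
    show "{f \<in> B. t' f = F p} \<subseteq> \<psi> ` {e \<in> A. t e = p}"
    proof
      fix f assume f: "f \<in> {f \<in> B. t' f = F p}"
      then obtain e where "e \<in> A" "f = \<psi> e"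
        using assms(1) by (auto simp: bij_betw_def)
      moreover from this f have "F (t e) = F p" using \<psi> by auto
      ultimately show "f \<in> \<psi> ` {e \<in> A. t e = p}"
        using assms(3,5) t by (auto dest: inj_onD)
    qed
  qed
  moreover have "inj_on \<psi> {e \<in> A. t e = p}"
    using assms(1) by (auto simp: bij_betw_def intro: inj_on_subset)
  ultimately show ?thesis by (simp add: card_image)
qed

text \<open>Abstracts the Schreier graphs. In place of inverses, \<open>T_sym\<close> asks that
  every step which moves a point can be undone by some generator, possibly depending on the
  point.\<close>

locale orbit_graphs =
  fixes S :: "'s set" and T :: "'s \<Rightarrow> 'v \<Rightarrow> 'v" and X :: "'v set"
  assumes finite_S: "finite S"
    and T_closed: "\<And>s y. s \<in> S \<Longrightarrow> y \<in> X \<Longrightarrow> T s y \<in> X"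
    and T_sym: "\<And>s y. s \<in> S \<Longrightarrow> y \<in> X \<Longrightarrow> T s y \<noteq> y \<Longrightarrow> \<exists>s'\<in>S. T s' (T s y) = y"
begin

definition short :: "nat \<Rightarrow> 's list set" where
  "short k = {u. set u \<subseteq> S \<and> length u \<le> k}"

definition orb :: "'v \<Rightarrow> 'v set" where
  "orb y = (\<lambda>u. fold T u y) ` lists S"

definition ograph :: "'v \<Rightarrow> ('v, 'v \<times> 's) pre_digraph" where
  "ograph y = \<lparr>verts = orb y, arcs = orb y \<times> S, tail = fst, head = (\<lambda>(y, s). T s y)\<rparr>"

definition nbr :: "'v \<Rightarrow> 'v set" where
  "nbr y = insert y ((\<lambda>s. T s y) ` S)"

definition steps :: "'v \<Rightarrow> 'v \<Rightarrow> nat" where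
  "steps y z = card {s \<in> S. T s y = z}"

text \<open>Edges between distinct points arise from arcs in both directions, whereas for a loop
  both directions describe the same arcs, which must be counted once.\<close>

definition edge_mult :: "'v \<Rightarrow> 'v \<Rightarrow> nat" where
  "edge_mult y z = (if y = z then steps y z else steps y z + steps z y)"

definition iso_map :: "'v \<Rightarrow> 'v \<Rightarrow> ('v \<Rightarrow> 'v) \<Rightarrow> bool" where
  "iso_map \<eta> \<xi> \<phi> \<longleftrightarrow> bij_betw \<phi> (orb \<eta>) (orb \<xi>) \<and> \<phi> \<eta> = \<xi> \<and>
     (\<forall>y\<in>orb \<eta>. \<forall>z\<in>orb \<eta>. edge_mult (\<phi> y) (\<phi> z) = edge_mult y z)"

lemma finite_short: "finite (short k)"
  unfolding short_def by (rule finite_lists_length_le[OF finite_S])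

lemma short_Suc: "short (Suc k) = insert [] {u @ [s] | u s. u \<in> short k \<and> s \<in> S}"
proof (rule Set.set_eqI)
  fix w show "w \<in> short (Suc k) \<longleftrightarrow> w \<in> insert [] {u @ [s] | u s. u \<in> short k \<and> s \<in> S}"
    by (cases w rule: rev_cases) (auto simp: short_def)
qed

lemma orb_UN_short: "orb y = (\<Union>k. (\<lambda>u. fold T u y) ` short k)"
  by (auto simp: orb_def short_def)

lemma orb_refl: "y \<in> orb y"
  unfolding orb_def by (rule image_eqI[of _ _ "[]"]) auto

lemma T_orb: "z \<in> orb y \<Longrightarrow> s \<in> S \<Longrightarrow> T s z \<in> orb y"
proof -
  assume "z \<in> orb y" "s \<in> S"
  then obtain u where u: "u \<in> lists S" "z = fold T u y" by (auto simp: orb_def)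
  then have "T s z = fold T (u @ [s]) y" by simp
  then show ?thesis unfolding orb_def using u(1) \<open>s \<in> S\<close> by (intro image_eqI[of _ _ "u @ [s]"]) auto
qed

lemma fold_closed: "u \<in> lists S \<Longrightarrow> y \<in> X \<Longrightarrow> fold T u y \<in> X"
  by (induction u arbitrary: y) (auto simp: T_closed)

lemma orb_subset: "y \<in> X \<Longrightarrow> orb y \<subseteq> X"
  by (auto simp: orb_def intro: fold_closed)

text \<open>\<open>fold\<close> lets the first letter of a word act first, so a further step appends
  a letter, in agreement with \<open>short_Suc\<close>.\<close>

lemma nball_nbr: "nball nbr k y = (\<lambda>u. fold T u y) ` short k"
proof (induction k)
  case 0
  then show ?case by (auto simp: short_def)
next
  case (Suc k)
  have sub: "short k \<subseteq> short (Suc k)" and Nil: "[] \<in> short k" by (auto simp: short_def)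
  have gen: "(\<Union>u\<in>A. insert (h u) ((\<lambda>s. h (u @ [s])) ` S)) = h ` (A \<union> {u @ [s] | u s. u \<in> A \<and> s \<in> S})"
    for h :: "'s list \<Rightarrow> 'v" and A
    by blast
  have "nball nbr (Suc k) y = (\<Union>u\<in>short k. insert (fold T u y) ((\<lambda>s. fold T (u @ [s]) y) ` S))"
    by (simp add: Suc nbr_def)
  also have "\<dots> = (\<lambda>u. fold T u y) ` (short k \<union> {u @ [s] | u s. u \<in> short k \<and> s \<in> S})"
    by (rule gen)
  also have "short k \<union> {u @ [s] | u s. u \<in> short k \<and> s \<in> S} = short (Suc k)"
    unfolding short_Suc using sub[unfolded short_Suc] Nil by blast
  finally show ?case .
qed

lemma nball_subset_orb: "nball nbr k y \<subseteq> orb y"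
  unfolding nball_nbr orb_UN_short by blast

lemma arcs_between:
  assumes "y \<in> orb x" "z \<in> orb x"
  shows "finite {e \<in> arcs (ograph x). {tail (ograph x) e, head (ograph x) e} = {y, z}}" (is "finite ?E")
    and "card {e \<in> arcs (ograph x). {tail (ograph x) e, head (ograph x) e} = {y, z}} = edge_mult y z"
proof -
  let ?A = "{y} \<times> {s \<in> S. T s y = z}" and ?B = "{z} \<times> {s \<in> S. T s z = y}"
  have E: "?E = ?A \<union> ?B"
    using assms by (auto simp: ograph_def doubleton_eq_iff)
  have fin: "finite ?A" "finite ?B" using finite_S by auto
  then show "finite ?E" unfolding E by blast
  show "card ?E = edge_mult y z"
  proof (cases "y = z")
    case True
    then show ?thesis unfolding E by (simp add: edge_mult_def steps_def card_cartesian_product)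
  next
    case False
    then have "?A \<inter> ?B = {}" by auto
    then have "card (?A \<union> ?B) = card ?A + card ?B" by (rule card_Un_disjoint[OF fin])
    then show ?thesis
      unfolding E using False by (simp add: edge_mult_def steps_def card_cartesian_product)
  qed
qed

section \<open>Isomorphisms as vertex maps preserving multiplicities\<close>

text \<open>For a given vertex map, a compatible bijection of edges exists iff all multiplicities
  agree, because any two points are joined by finitely many edges. \<open>P\<close> collects the
  unordered pairs of points, on which a bijection of orbits acts injectively by
  \<open>image\<close>.\<close>

lemma iso_iff_iso_map:
  "rooted_undirected_iso (ograph \<eta>) \<eta> (ograph \<xi>) \<xi> \<longleftrightarrow> (\<exists>\<phi>. iso_map \<eta> \<xi> \<phi>)"
proof -
  let ?G = "ograph \<eta>" and ?H = "ograph \<xi>"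
  define P where "P x = {{y, z} | y z. y \<in> orb x \<and> z \<in> orb x}" for x
  have ends: "{tail (ograph x) e, head (ograph x) e} \<in> P x" if e: "e \<in> arcs (ograph x)" for x e
  proof -
    obtain y s where "e = (y, s)" "y \<in> orb x" "s \<in> S"
      using e by (cases e) (auto simp: ograph_def)
    moreover from this have "T s y \<in> orb x" by (intro T_orb)
    ultimately show ?thesis unfolding P_def ograph_def by auto
  qed
  have inj: "inj_on (image \<phi>) (P \<eta>)" if "bij_betw \<phi> (orb \<eta>) (orb \<xi>)" for \<phi>
    using inj_on_image_Pow[OF bij_betw_imp_inj_on[OF that]]
    by (rule inj_on_subset) (auto simp: P_def)
  show ?thesis
  proof
    assume "rooted_undirected_iso ?G \<eta> ?H \<xi>"
    then obtain \<phi> \<psi> where *: "bij_betw \<phi> (orb \<eta>) (orb \<xi>)" "bij_betw \<psi> (arcs ?G) (arcs ?H)"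
      "\<And>e. e \<in> arcs ?G \<Longrightarrow> {tail ?H (\<psi> e), head ?H (\<psi> e)} = \<phi> ` {tail ?G e, head ?G e}" "\<phi> \<eta> = \<xi>"
      unfolding rooted_undirected_iso_def by (auto simp: ograph_def)
    have "edge_mult (\<phi> y) (\<phi> z) = edge_mult y z" if "y \<in> orb \<eta>" "z \<in> orb \<eta>" for y z
    proof -
      have "card {f \<in> arcs ?H. {tail ?H f, head ?H f} = \<phi> ` {y, z}}
          = card {e \<in> arcs ?G. {tail ?G e, head ?G e} = {y, z}}"
        by (rule card_fibres_bij_betw[where t = "\<lambda>e. {tail ?G e, head ?G e}" and F = "image \<phi>"
              and P = "P \<eta>", OF *(2,3) inj[OF *(1)] ends])
          (use that in \<open>auto simp: P_def\<close>)
      moreover have "\<phi> y \<in> orb \<xi>" "\<phi> z \<in> orb \<xi>" using that bij_betwE[OF *(1)] by auto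
      ultimately show ?thesis using arcs_between(2) that by simp
    qed
    then show "\<exists>\<phi>. iso_map \<eta> \<xi> \<phi>" using * unfolding iso_map_def by blast
  next
    assume "\<exists>\<phi>. iso_map \<eta> \<xi> \<phi>"
    then obtain \<phi> where \<phi>: "bij_betw \<phi> (orb \<eta>) (orb \<xi>)" "\<phi> \<eta> = \<xi>"
      "\<And>y z. y \<in> orb \<eta> \<Longrightarrow> z \<in> orb \<eta> \<Longrightarrow> edge_mult (\<phi> y) (\<phi> z) = edge_mult y z"
      unfolding iso_map_def by blast
    have mem: "\<phi> y \<in> orb \<xi>" if "y \<in> orb \<eta>" for y using bij_betwE[OF \<phi>(1)] that by blast
    have "\<exists>\<psi>. bij_betw \<psi> (arcs ?G) (arcs ?H) \<and>
        (\<forall>e\<in>arcs ?G. {tail ?H (\<psi> e), head ?H (\<psi> e)} = \<phi> ` {tail ?G e, head ?G e})"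
    proof (rule bij_betw_fibres[where t = "\<lambda>e. {tail ?G e, head ?G e}" and F = "image \<phi>"
          and t' = "\<lambda>e. {tail ?H e, head ?H e}" and P = "P \<eta>" and Q = "P \<xi>"])
      have "image \<phi> ` P \<eta> = P \<xi>"
      proof
        show "image \<phi> ` P \<eta> \<subseteq> P \<xi>" using mem by (auto simp: P_def)
        show "P \<xi> \<subseteq> image \<phi> ` P \<eta>"
        proof
          fix q assume "q \<in> P \<xi>"
          then obtain y' z' where "y' \<in> orb \<xi>" "z' \<in> orb \<xi>" and q: "q = {y', z'}"
            unfolding P_def by blast
          then obtain y z where "y \<in> orb \<eta>" "z \<in> orb \<eta>" "y' = \<phi> y" "z' = \<phi> z"
            unfolding bij_betw_imp_surj_on[OF \<phi>(1), symmetric] by blast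
          then show "q \<in> image \<phi> ` P \<eta>"
            unfolding P_def q by (intro image_eqI[of _ _ "{y, z}"]) auto
        qed
      qed
      then show "bij_betw (image \<phi>) (P \<eta>) (P \<xi>)" using inj[OF \<phi>(1)] by (simp add: bij_betw_def)
    next
      fix p assume "p \<in> P \<eta>"
      then obtain y z where yz: "y \<in> orb \<eta>" "z \<in> orb \<eta>" "p = {y, z}" unfolding P_def by blast
      then show "card {e \<in> arcs ?G. {tail ?G e, head ?G e} = p} =
          card {f \<in> arcs ?H. {tail ?H f, head ?H f} = \<phi> ` p}"
        using arcs_between(2)[OF yz(1,2)] arcs_between(2)[OF mem[OF yz(1)] mem[OF yz(2)]] \<phi>(3) by simp
    next
      fix p assume "p \<in> P \<eta>"
      then obtain y z where "y \<in> orb \<eta>" "z \<in> orb \<eta>" and p: "p = {y, z}" unfolding P_def by blast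
      then show "finite {e \<in> arcs ?G. {tail ?G e, head ?G e} = p}"
        unfolding p by (intro arcs_between(1))
    next
      fix p assume "p \<in> P \<xi>"
      then obtain y z where "y \<in> orb \<xi>" "z \<in> orb \<xi>" and p: "p = {y, z}" unfolding P_def by blast
      then show "finite {e \<in> arcs ?H. {tail ?H e, head ?H e} = p}"
        unfolding p by (intro arcs_between(1))
    qed (rule ends; assumption)+
    then show "rooted_undirected_iso ?G \<eta> ?H \<xi>"
      unfolding rooted_undirected_iso_def using \<phi> by (auto simp: ograph_def)
  qed
qed

text \<open>Multiplicities forget the direction of arcs, so \<open>T_sym\<close> has to turn an arc
  from \<open>z\<close> to \<open>y\<close> around. Adjacency, and with it the balls, thus becomes
  visible to \<open>iso_map\<close>.\<close>

lemma nbr_iff_edge_mult: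
  assumes "y \<in> X" "z \<in> X" shows "z \<in> nbr y \<longleftrightarrow> z = y \<or> edge_mult y z > 0"
proof -
  have *: "steps y z > 0 \<longleftrightarrow> (\<exists>s\<in>S. T s y = z)" for y z
    unfolding steps_def using finite_S by (auto simp: card_gt_0_iff)
  show ?thesis
    unfolding nbr_def edge_mult_def using *[of y z] *[of z y] T_sym[of _ z] assms by auto
qed

lemma iso_map_inverse:
  assumes "iso_map \<eta> \<xi> \<phi>" shows "iso_map \<xi> \<eta> (the_inv_into (orb \<eta>) \<phi>)"
proof -
  let ?i = "the_inv_into (orb \<eta>) \<phi>"
  have b: "bij_betw \<phi> (orb \<eta>) (orb \<xi>)" and r: "\<phi> \<eta> = \<xi>" using assms by (auto simp: iso_map_def)
  have b': "bij_betw ?i (orb \<xi>) (orb \<eta>)" by (rule bij_betw_the_inv_into[OF b])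
  have "?i \<xi> = \<eta>" using r orb_refl by (metis b bij_betw_def the_inv_into_f_f)
  moreover have "edge_mult (?i y) (?i z) = edge_mult y z" if "y \<in> orb \<xi>" "z \<in> orb \<xi>" for y z
  proof -
    have "?i y \<in> orb \<eta>" "?i z \<in> orb \<eta>" using bij_betwE[OF b'] that by auto
    moreover have "\<phi> (?i y) = y" "\<phi> (?i z) = z"
      using f_the_inv_into_f_bij_betw[OF b] that by auto
    ultimately show ?thesis using assms unfolding iso_map_def by metis
  qed
  ultimately show ?thesis unfolding iso_map_def using b' by blast
qed

lemma iso_map_ball_subset:
  assumes "iso_map \<eta> \<xi> \<phi>" "\<eta> \<in> X" "\<xi> \<in> X"
  shows "\<phi> ` nball nbr k \<eta> \<subseteq> nball nbr k \<xi>"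
proof (induction k)
  case 0
  then show ?case using assms(1) by (simp add: iso_map_def)
next
  case (Suc k)
  show ?case
  proof
    fix x assume "x \<in> \<phi> ` nball nbr (Suc k) \<eta>"
    then obtain y z where yz: "y \<in> nball nbr k \<eta>" "z \<in> nbr y" "x = \<phi> z" by auto
    have zorb: "z \<in> orb \<eta>" using yz nball_subset_orb[of "Suc k" \<eta>] by auto
    have yorb: "y \<in> orb \<eta>" using yz nball_subset_orb by blast
    have im: "\<phi> y \<in> orb \<xi>" "\<phi> z \<in> orb \<xi>"
      using assms(1) yorb zorb by (auto simp: iso_map_def dest: bij_betwE)
    have "y \<in> X" "z \<in> X" using yorb zorb orb_subset[OF assms(2)] by auto
    from nbr_iff_edge_mult[OF this] have "z = y \<or> edge_mult y z > 0" using yz(2) by simp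
    moreover have "edge_mult (\<phi> y) (\<phi> z) = edge_mult y z"
      using assms(1) yorb zorb unfolding iso_map_def by blast
    ultimately have "\<phi> z = \<phi> y \<or> edge_mult (\<phi> y) (\<phi> z) > 0" by metis
    moreover have "\<phi> y \<in> X" "\<phi> z \<in> X" using im orb_subset[OF assms(3)] by auto
    ultimately have "\<phi> z \<in> nbr (\<phi> y)" using nbr_iff_edge_mult[of "\<phi> y" "\<phi> z"] by simp
    then show "x \<in> nball nbr (Suc k) \<xi>" using yz Suc by auto
  qed
qed

lemma iso_map_ball:
  assumes "iso_map \<eta> \<xi> \<phi>" "\<eta> \<in> X" "\<xi> \<in> X"
  shows "\<phi> ` nball nbr k \<eta> = nball nbr k \<xi>"
proof
  show "\<phi> ` nball nbr k \<eta> \<subseteq> nball nbr k \<xi>" by (rule iso_map_ball_subset[OF assms])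
  have b: "bij_betw \<phi> (orb \<eta>) (orb \<xi>)" using assms by (auto simp: iso_map_def)
  show "nball nbr k \<xi> \<subseteq> \<phi> ` nball nbr k \<eta>"
  proof
    fix x assume x: "x \<in> nball nbr k \<xi>"
    then have "the_inv_into (orb \<eta>) \<phi> x \<in> nball nbr k \<eta>"
      using iso_map_ball_subset[OF iso_map_inverse] assms by blast
    moreover have "x = \<phi> (the_inv_into (orb \<eta>) \<phi> x)"
      using f_the_inv_into_f_bij_betw[OF b] x nball_subset_orb by fastforce
    ultimately show "x \<in> \<phi> ` nball nbr k \<eta>" by blast
  qed
qed

lemma iso_card_ball:
  assumes "rooted_undirected_iso (ograph \<eta>) \<eta> (ograph \<xi>) \<xi>" "\<eta> \<in> X" "\<xi> \<in> X"
  shows "card (nball nbr k \<eta>) = card (nball nbr k \<xi>)"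
proof -
  from assms obtain \<phi> where \<phi>: "iso_map \<eta> \<xi> \<phi>" unfolding iso_iff_iso_map by blast
  then have "inj_on \<phi> (nball nbr k \<eta>)"
    using nball_subset_orb by (auto simp: iso_map_def bij_betw_def intro: inj_on_subset)
  then show ?thesis using iso_map_ball[OF \<phi> assms(2,3)] card_image by metis
qed

section \<open>Coding isomorphisms of balls by words\<close>

text \<open>\<open>f u\<close> is a word leading from \<open>\<xi>\<close> to the image of the point
  that \<open>u\<close> leads to from \<open>\<eta>\<close>. Naming points by words leaves finitely
  many candidates on \<open>short R\<close>, the same for all \<open>\<eta>\<close>. The bounds on
  lengths ensure this finiteness, fix the root, and let a matching be restricted to smaller
  radii.\<close>

definition matching :: "nat \<Rightarrow> ('s list \<Rightarrow> 's list) \<Rightarrow> 'v \<Rightarrow> 'v \<Rightarrow> bool" where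
  "matching R f \<eta> \<xi> \<longleftrightarrow>
     (\<forall>u\<in>short R. f u \<in> short (length u)) \<and>
     (\<forall>v\<in>short R. \<exists>u\<in>short (length v). fold T (f u) \<xi> = fold T v \<xi>) \<and>
     (\<forall>u\<in>short R. \<forall>v\<in>short R.
        (fold T u \<eta> = fold T v \<eta> \<longleftrightarrow> fold T (f u) \<xi> = fold T (f v) \<xi>) \<and>
        edge_mult (fold T u \<eta>) (fold T v \<eta>) = edge_mult (fold T (f u) \<xi>) (fold T (f v) \<xi>))"

lemma short_mono: "k \<le> l \<Longrightarrow> short k \<subseteq> short l"
  by (auto simp: short_def)

lemma short_length: "u \<in> short k \<Longrightarrow> length u \<le> k"
  by (auto simp: short_def)

lemma matching_cong:
  assumes m: "matching R f \<eta> \<xi>" and "R' \<le> R" and eq: "\<And>u. u \<in> short R' \<Longrightarrow> g u = f u"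
  shows "matching R' g \<eta> \<xi>"
proof -
  have sub: "short R' \<subseteq> short R" using \<open>R' \<le> R\<close> by (rule short_mono)
  have eq': "g u = f u" if "u \<in> short (length v)" "v \<in> short R'" for u v
    using that eq short_mono[of "length v" R'] short_length by blast
  show ?thesis
    unfolding matching_def
  proof (rule conjI, goal_cases)
    case 1
    then show ?case using m sub unfolding matching_def by (auto simp: eq)
  next
    case 2
    have "\<exists>u\<in>short (length v). fold T (g u) \<xi> = fold T v \<xi>" if v: "v \<in> short R'" for v
    proof -
      from v sub m obtain u where u: "u \<in> short (length v)" "fold T (f u) \<xi> = fold T v \<xi>"
        unfolding matching_def by blast
      then show ?thesis using eq'[OF u(1) v] by (intro bexI[of _ u]) simp_all
    qed
    then show ?case using m sub unfolding matching_def by (simp add: eq subset_iff)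
  qed
qed

text \<open>A single \<open>f\<close> serves every radius: \<open>\<phi>\<close> maps balls onto
  balls, so the image of the end point of \<open>u\<close> is the end point of a word no longer than
  \<open>u\<close>, and likewise for preimages.\<close>

lemma iso_map_imp_matching:
  assumes "iso_map \<eta> \<xi> \<phi>" "\<eta> \<in> X" "\<xi> \<in> X"
  shows "\<exists>f. \<forall>R. matching R f \<eta> \<xi>"
proof -
  have mem: "fold T u \<eta> \<in> orb \<eta>" if "u \<in> short R" for u R
    using that by (auto simp: orb_def short_def)
  have "\<exists>v\<in>short (length u). fold T v \<xi> = \<phi> (fold T u \<eta>)" if "u \<in> short R" for u R
  proof -
    have "fold T u \<eta> \<in> nball nbr (length u) \<eta>"
      unfolding nball_nbr using that by (auto simp: short_def)
    then have "\<phi> (fold T u \<eta>) \<in> nball nbr (length u) \<xi>"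
      using iso_map_ball[OF assms] by blast
    then show ?thesis unfolding nball_nbr by auto
  qed
  then obtain f where f: "\<And>u R. u \<in> short R \<Longrightarrow> f u \<in> short (length u)"
    "\<And>u R. u \<in> short R \<Longrightarrow> fold T (f u) \<xi> = \<phi> (fold T u \<eta>)" by metis
  have "\<exists>u\<in>short (length v). fold T (f u) \<xi> = fold T v \<xi>" if "v \<in> short R" for v R
  proof -
    have "fold T v \<xi> \<in> nball nbr (length v) \<xi>"
      unfolding nball_nbr using that by (auto simp: short_def)
    then have "fold T v \<xi> \<in> \<phi> ` nball nbr (length v) \<eta>"
      using iso_map_ball[OF assms] by simp
    then show ?thesis using f(2) unfolding nball_nbr by auto
  qed
  moreover have "\<phi> (fold T u \<eta>) = \<phi> (fold T v \<eta>) \<longleftrightarrow> fold T u \<eta> = fold T v \<eta>"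
    if "u \<in> short R" "v \<in> short R" for u v R
  proof -
    have "inj_on \<phi> (orb \<eta>)" using assms(1) by (simp add: iso_map_def bij_betw_def)
    then show ?thesis using mem[OF that(1)] mem[OF that(2)] by (rule inj_on_eq_iff)
  qed
  moreover have "edge_mult (\<phi> (fold T u \<eta>)) (\<phi> (fold T v \<eta>)) = edge_mult (fold T u \<eta>) (fold T v \<eta>)"
    if "u \<in> short R" "v \<in> short R" for u v R
    using assms(1) mem that unfolding iso_map_def by blast
  ultimately have "matching R f \<eta> \<xi>" for R
    using f unfolding matching_def by simp
  then show ?thesis by blast
qed

lemma matching_imp_iso_map:
  assumes m: "\<And>R. matching R f \<eta> \<xi>"
  shows "\<exists>\<phi>. iso_map \<eta> \<xi> \<phi>"
proof -
  have eq: "fold T u \<eta> = fold T v \<eta> \<longleftrightarrow> fold T (f u) \<xi> = fold T (f v) \<xi>"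
    and em: "edge_mult (fold T u \<eta>) (fold T v \<eta>) = edge_mult (fold T (f u) \<xi>) (fold T (f v) \<xi>)"
    if "u \<in> lists S" "v \<in> lists S" for u v
  proof -
    define R where "R = max (length u) (length v)"
    have "u \<in> short R" "v \<in> short R" using that by (auto simp: short_def R_def)
    then show "fold T u \<eta> = fold T v \<eta> \<longleftrightarrow> fold T (f u) \<xi> = fold T (f v) \<xi>"
      "edge_mult (fold T u \<eta>) (fold T v \<eta>) = edge_mult (fold T (f u) \<xi>) (fold T (f v) \<xi>)"
      using m[of R] unfolding matching_def by blast+
  qed
  have fS: "f u \<in> short (length u)" if "u \<in> lists S" for u
    using m[of "length u"] that unfolding matching_def by (auto simp: short_def)
  have surj: "\<exists>u\<in>lists S. fold T (f u) \<xi> = fold T v \<xi>" if "v \<in> lists S" for v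
    using m[of "length v"] that unfolding matching_def by (fastforce simp: short_def)
  \<comment> \<open>A point may be named by many words; one is selected, and \<open>eq\<close> makes
    the value of \<open>\<phi>\<close> independent of the selection.\<close>
  define w where "w y = (SOME u. u \<in> lists S \<and> fold T u \<eta> = y)" for y
  have w: "w y \<in> lists S" "fold T (w y) \<eta> = y" if "y \<in> orb \<eta>" for y
    using someI_ex[of "\<lambda>u. u \<in> lists S \<and> fold T u \<eta> = y"] that by (auto simp: w_def orb_def)
  define \<phi> where "\<phi> y = fold T (f (w y)) \<xi>" for y
  have \<phi>: "\<phi> (fold T u \<eta>) = fold T (f u) \<xi>" if "u \<in> lists S" for u
    unfolding \<phi>_def using w[of "fold T u \<eta>"] that eq[of "w (fold T u \<eta>)" u] by (auto simp: orb_def)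
  have "bij_betw \<phi> (orb \<eta>) (orb \<xi>)"
  proof (rule bij_betwI')
    fix y z assume "y \<in> orb \<eta>" "z \<in> orb \<eta>"
    then show "\<phi> y = \<phi> z \<longleftrightarrow> y = z" using w eq unfolding \<phi>_def by metis
  next
    fix y assume "y \<in> orb \<eta>"
    then have "f (w y) \<in> lists S" using fS[OF w(1)] by (auto simp: short_def)
    then show "\<phi> y \<in> orb \<xi>" unfolding \<phi>_def orb_def by (rule imageI)
  next
    fix x assume "x \<in> orb \<xi>"
    then obtain v where "v \<in> lists S" "x = fold T v \<xi>" by (auto simp: orb_def)
    then obtain u where "u \<in> lists S" "x = fold T (f u) \<xi>" using surj by metis
    then show "\<exists>y\<in>orb \<eta>. x = \<phi> y" using \<phi> unfolding orb_def by (intro bexI[of _ "fold T u \<eta>"]) auto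
  qed
  \<comment> \<open>The bound on lengths forces \<open>f []\<close> to be empty.\<close>
  moreover have "\<phi> \<eta> = \<xi>"
    using \<phi>[of "[]"] fS[of "[]"] by (simp add: short_def)
  moreover have "edge_mult (\<phi> y) (\<phi> z) = edge_mult y z" if "y \<in> orb \<eta>" "z \<in> orb \<eta>" for y z
    using em[of "w y" "w z"] w that unfolding \<phi>_def by simp
  ultimately show ?thesis unfolding iso_map_def by blast
qed

lemma iso_iff_matching:
  assumes "\<eta> \<in> X" "\<xi> \<in> X"
  shows "rooted_undirected_iso (ograph \<eta>) \<eta> (ograph \<xi>) \<xi> \<longleftrightarrow> (\<forall>R. \<exists>f. matching R f \<eta> \<xi>)"
proof
  assume "rooted_undirected_iso (ograph \<eta>) \<eta> (ograph \<xi>) \<xi>"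
  then show "\<forall>R. \<exists>f. matching R f \<eta> \<xi>"
    using iso_map_imp_matching assms unfolding iso_iff_iso_map by blast
next
  assume "\<forall>R. \<exists>f. matching R f \<eta> \<xi>"
  then obtain f where f: "\<And>R. matching R (f R) \<eta> \<xi>" by metis
  \<comment> \<open>The default \<open>[]\<close> keeps \<open>f' R u\<close> in the finite set
    \<open>short (length u)\<close> also where \<open>f R\<close> is unconstrained, as the
    compactness argument requires.\<close>
  define f' where "f' R u = (if u \<in> short R then f R u else [])" for R u
  have m: "matching R (f' R) \<eta> \<xi>" for R
    by (rule matching_cong[OF f]) (auto simp: f'_def)
  have "\<exists>g. \<forall>U n. finite U \<longrightarrow> U \<subseteq> lists S \<longrightarrow> (\<exists>R\<ge>n. \<forall>u\<in>U. f' R u = g u)"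
  proof (rule limit_of_finite_choices)
    show "countable (lists S)" using finite_S by (simp add: countable_finite)
    show "f' R u \<in> short (length u)" for R u
      using f[of R] by (auto simp: f'_def matching_def short_def)
  qed (rule finite_short)
  then obtain g where g: "\<And>U n. finite U \<Longrightarrow> U \<subseteq> lists S \<Longrightarrow> \<exists>R\<ge>n. \<forall>u\<in>U. f' R u = g u"
    by blast
  have "matching R g \<eta> \<xi>" for R
  proof -
    have "short R \<subseteq> lists S" by (auto simp: short_def)
    from g[OF finite_short this, of R] obtain R' where "R' \<ge> R" "\<forall>u\<in>short R. f' R' u = g u" by blast
    then show ?thesis by (intro matching_cong[OF m[of R']]) auto
  qed
  then show "rooted_undirected_iso (ograph \<eta>) \<eta> (ograph \<xi>) \<xi>"
    unfolding iso_iff_iso_map by (rule matching_imp_iso_map)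
qed

text \<open>The multiplicities in \<open>matching\<close> have to be reduced to equations between
  measurable maps as well. The union over \<open>f\<close> is made finite, and the intersection over
  \<open>R\<close> is countable.\<close>

lemma iso_class_measurable:
  assumes "space M = X" and T_meas: "\<And>s. s \<in> S \<Longrightarrow> T s \<in> M \<rightarrow>\<^sub>M M"
    and eq_meas: "\<And>f g. f \<in> M \<rightarrow>\<^sub>M M \<Longrightarrow> g \<in> M \<rightarrow>\<^sub>M M \<Longrightarrow> {x \<in> space M. f x = g x} \<in> sets M"
    and "\<xi> \<in> X"
  shows "{\<eta> \<in> X. rooted_undirected_iso (ograph \<eta>) \<eta> (ograph \<xi>) \<xi>} \<in> sets M"
proof -
  have act: "fold T u \<in> M \<rightarrow>\<^sub>M M" if "u \<in> lists S" for u
    using that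
  proof (induction u)
    case (Cons s u)
    then have "fold T u \<circ> T s \<in> M \<rightarrow>\<^sub>M M" using T_meas by (auto intro: measurable_comp)
    then show ?case by (simp add: comp_def)
  qed (simp add: id_def)
  have eqp: "Measurable.pred M (\<lambda>x. f x = g x)" if "f \<in> M \<rightarrow>\<^sub>M M" "g \<in> M \<rightarrow>\<^sub>M M" for f g
    using eq_meas[OF that] by (simp add: pred_def)
  have steps: "Measurable.pred M (\<lambda>x. steps (f x) (g x) = k)"
    if fg: "f \<in> M \<rightarrow>\<^sub>M M" "g \<in> M \<rightarrow>\<^sub>M M" for f g k
  proof -
    \<comment> \<open>A count is expressed through the finitely many possible sets \<open>Z\<close>
      of contributing generators, each described by finitely many equations and negated
      equations.\<close>
    have "(steps (f x) (g x) = k) \<longleftrightarrow> (\<exists>Z\<in>{Z \<in> Pow S. card Z = k}. \<forall>s\<in>S. T s (f x) = g x \<longleftrightarrow> s \<in> Z)" for x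
    proof
      assume "steps (f x) (g x) = k"
      then show "\<exists>Z\<in>{Z \<in> Pow S. card Z = k}. \<forall>s\<in>S. T s (f x) = g x \<longleftrightarrow> s \<in> Z"
        by (intro bexI[of _ "{s \<in> S. T s (f x) = g x}"]) (auto simp: steps_def)
    next
      assume "\<exists>Z\<in>{Z \<in> Pow S. card Z = k}. \<forall>s\<in>S. T s (f x) = g x \<longleftrightarrow> s \<in> Z"
      then obtain Z where "Z \<subseteq> S" "card Z = k" "\<forall>s\<in>S. T s (f x) = g x \<longleftrightarrow> s \<in> Z" by blast
      moreover from this have "{s \<in> S. T s (f x) = g x} = Z" by blast
      ultimately show "steps (f x) (g x) = k" by (simp add: steps_def)
    qed
    moreover have "Measurable.pred M (\<lambda>x. T s (f x) = g x \<longleftrightarrow> s \<in> Z)" if "s \<in> S" for s Z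
    proof -
      have [measurable]: "Measurable.pred M (\<lambda>x. T s (f x) = g x)"
        by (rule eqp[OF measurable_compose[OF fg(1) T_meas[OF that]] fg(2)])
      show ?thesis by measurable
    qed
    ultimately show ?thesis
      using finite_S by (simp only:) (intro pred_intros_finite; simp)
  qed
  have edge_mult: "Measurable.pred M (\<lambda>x. edge_mult (f x) (g x) = k)"
    if fg: "f \<in> M \<rightarrow>\<^sub>M M" "g \<in> M \<rightarrow>\<^sub>M M" for f g k
  proof -
    have [measurable]: "Measurable.pred M (\<lambda>x. f x = g x)" by (rule eqp[OF fg])
    have [measurable]: "Measurable.pred M (\<lambda>x. steps (f x) (g x) = i)"
      "Measurable.pred M (\<lambda>x. steps (g x) (f x) = i)" for i
      by (rule steps[OF fg], rule steps[OF fg(2,1)])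
    have eq: "(\<lambda>x. edge_mult (f x) (g x) = k) = (\<lambda>x. (f x = g x \<and> steps (f x) (g x) = k) \<or>
        (\<not> f x = g x \<and> (\<exists>i\<in>{..k}. steps (f x) (g x) = i \<and> steps (g x) (f x) = k - i)))"
      by (rule ext) (auto simp: edge_mult_def)
    show ?thesis unfolding eq by measurable
  qed
  have match: "Measurable.pred M (\<lambda>\<eta>. matching R f \<eta> \<xi>)" for R f
  proof -
    have "fold T u \<in> M \<rightarrow>\<^sub>M M" if "u \<in> short R" for u
      using that by (auto intro!: act simp: short_def)
    then show ?thesis
      unfolding matching_def
      by (intro pred_intros_logic pred_intros_finite finite_short) (auto intro: eqp edge_mult)
  qed
  \<comment> \<open>Only the values on \<open>short R\<close> matter, so \<open>f\<close> may range
    over a finite set of functions.\<close>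
  have "(\<exists>f. matching R f \<eta> \<xi>) \<longleftrightarrow> (\<exists>f\<in>Pi\<^sub>E (short R) (\<lambda>u. short (length u)). matching R f \<eta> \<xi>)" for R \<eta>
  proof
    assume "\<exists>f. matching R f \<eta> \<xi>"
    then obtain f where f: "matching R f \<eta> \<xi>" by blast
    then have "matching R (restrict f (short R)) \<eta> \<xi>" by (rule matching_cong) auto
    moreover have "restrict f (short R) \<in> Pi\<^sub>E (short R) (\<lambda>u. short (length u))"
      using f by (auto simp: matching_def)
    ultimately show "\<exists>f\<in>Pi\<^sub>E (short R) (\<lambda>u. short (length u)). matching R f \<eta> \<xi>" by blast
  qed blast
  moreover have "finite (Pi\<^sub>E (short R) (\<lambda>u. short (length u)))" for R
    by (intro finite_PiE finite_short)
  ultimately have "Measurable.pred M (\<lambda>\<eta>. \<exists>f. matching R f \<eta> \<xi>)" for R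
    using match by (auto intro: pred_intros_finite)
  then have "Measurable.pred M (\<lambda>\<eta>. \<forall>R. \<exists>f. matching R f \<eta> \<xi>)"
    by (rule pred_intros_countable)
  then have "{\<eta> \<in> X. \<forall>R. \<exists>f. matching R f \<eta> \<xi>} \<in> sets M"
    using \<open>space M = X\<close> by (simp add: pred_def)
  moreover have "{\<eta> \<in> X. rooted_undirected_iso (ograph \<eta>) \<eta> (ograph \<xi>) \<xi>}
      = {\<eta> \<in> X. \<forall>R. \<exists>f. matching R f \<eta> \<xi>}"
    using iso_iff_matching[OF _ \<open>\<xi> \<in> X\<close>] by blast
  ultimately show ?thesis by simp
qed

end

section \<open>The Bernoulli measure\<close>

lemma space_bernoulli: "space (bernoulli_measure d) = tree_boundary d"
  by (simp add: bernoulli_measure_def space_PiM space_uniform_count_measure PiE_UNIV_domain)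

lemma bernoulli_coord_meas: "{\<xi> \<in> tree_boundary d. \<xi> n = c} \<in> sets (bernoulli_measure d)"
proof (cases "c \<in> letters d")
  case True
  have "(\<lambda>\<xi>. \<xi> n) \<in> bernoulli_measure d \<rightarrow>\<^sub>M uniform_count_measure (letters d)"
    unfolding bernoulli_measure_def by (rule measurable_component_singleton) simp
  then have "(\<lambda>\<xi>. \<xi> n) -` {c} \<inter> space (bernoulli_measure d) \<in> sets (bernoulli_measure d)"
    by (rule measurable_sets) (use True in \<open>simp add: sets_uniform_count_measure\<close>)
  also have "(\<lambda>\<xi>. \<xi> n) -` {c} \<inter> space (bernoulli_measure d) = {\<xi> \<in> tree_boundary d. \<xi> n = c}"
    by (auto simp: space_bernoulli)
  finally show ?thesis .
next
  case False
  then have "{\<xi> \<in> tree_boundary d. \<xi> n = c} = {}" by (auto simp: Pi_iff)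
  then show ?thesis by (simp only: sets.empty_sets)
qed

lemma cylinder_meas: "{\<xi> \<in> tree_boundary d. \<forall>i<n. \<xi> i = w i} \<in> sets (bernoulli_measure d)"
proof (induction n)
  case 0
  then show ?case using sets.top[of "bernoulli_measure d"] by (simp add: space_bernoulli)
next
  case (Suc n)
  have "{\<xi> \<in> tree_boundary d. \<forall>i<Suc n. \<xi> i = w i}
      = {\<xi> \<in> tree_boundary d. \<forall>i<n. \<xi> i = w i} \<inter> {\<xi> \<in> tree_boundary d. \<xi> n = w n}"
    by (auto simp: less_Suc_eq)
  then show ?case by (simp only:) (rule sets.Int[OF Suc bernoulli_coord_meas])
qed

lemma measure_cylinder:
  assumes "d \<ge> 1" "\<And>i. i < n \<Longrightarrow> w i \<in> letters d"
  shows "measure (bernoulli_measure d) {\<xi> \<in> tree_boundary d. \<forall>i<n. \<xi> i = w i} = (1 / d) ^ n"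
proof -
  let ?M = "\<lambda>_ :: nat. uniform_count_measure (letters d)"
  interpret product_prob_space ?M UNIV
    unfolding product_prob_space_def product_sigma_finite_def product_prob_space_axioms_def
    by (intro conjI allI prob_space_uniform_count_measure prob_space_imp_sigma_finite finite_letters
        letters_nonempty \<open>d \<ge> 1\<close>)
  have "{\<xi> \<in> tree_boundary d. \<forall>i<n. \<xi> i = w i} = prod_emb UNIV ?M {..<n} (Pi\<^sub>E {..<n} (\<lambda>i. {w i}))"
    by (auto simp: prod_emb_def space_uniform_count_measure PiE_iff PiE_UNIV_domain)
  then have "measure (bernoulli_measure d) {\<xi> \<in> tree_boundary d. \<forall>i<n. \<xi> i = w i}
      = measure (PiM UNIV ?M) (prod_emb UNIV ?M {..<n} (Pi\<^sub>E {..<n} (\<lambda>i. {w i})))"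
    by (simp add: bernoulli_measure_def)
  also have "\<dots> = (\<Prod>i<n. measure (?M i) {w i})"
    by (rule measure_PiM_emb) (use assms in \<open>auto simp: sets_uniform_count_measure\<close>)
  also have "\<dots> = (\<Prod>i<n. 1 / d)"
    by (rule prod.cong)
      (use assms in \<open>auto simp: measure_uniform_count_measure finite_letters card_letters\<close>)
  finally show ?thesis by simp
qed

lemma prob_space_bernoulli: "d \<ge> 1 \<Longrightarrow> prob_space (bernoulli_measure d)"
  unfolding bernoulli_measure_def
  by (intro prob_space_PiM prob_space_uniform_count_measure finite_letters letters_nonempty)

text \<open>A nonempty prefix cannot be continued in \<open>C\<close> by both 0 and 1, so every
  letter after the first costs a factor (d-1)/d. As \<open>sep\<close> speaks of positions
  \<open>n \<ge> 1\<close>, the first letter is left free.\<close>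

lemma null_set_if_forbidden_letters:
  assumes "d \<ge> 2" "C \<in> sets (bernoulli_measure d)"
    and sep: "\<And>y y' n. n \<ge> 1 \<Longrightarrow> y \<in> C \<Longrightarrow> y' \<in> C \<Longrightarrow> (\<And>i. i < n \<Longrightarrow> y' i = y i) \<Longrightarrow> y n = 1 \<Longrightarrow> y' n \<noteq> 0"
  shows "C \<in> null_sets (bernoulli_measure d)"
proof -
  interpret prob_space "bernoulli_measure d" by (rule prob_space_bernoulli) (use \<open>d \<ge> 2\<close> in simp)
  have C: "C \<subseteq> tree_boundary d"
    using sets.sets_into_space[OF assms(2)] by (simp add: space_bernoulli)
  then have letter: "\<eta> i \<in> letters d" if "\<eta> \<in> C" for \<eta> i using that by (auto simp: Pi_iff subset_iff)
  define W where "W n = (\<lambda>\<eta>. map \<eta> [0..<n]) ` C" for n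
  have finW: "finite (W n)" for n
    by (rule finite_subset[OF _ finite_lists_length_le[OF finite_letters, of d n]])
      (use letter in \<open>auto simp: W_def\<close>)
  have card_W: "card (W (Suc n)) \<le> d * (d - 1) ^ n" for n
  proof (induction n)
    case 0
    have "W (Suc 0) \<subseteq> (\<lambda>x. [x]) ` letters d" using letter by (auto simp: W_def)
    then have "card (W (Suc 0)) \<le> card ((\<lambda>x. [x]) ` letters d)"
      by (intro card_mono finite_imageI finite_letters)
    also have "\<dots> \<le> d" using card_image_le[OF finite_letters] card_letters by metis
    finally show ?case by simp
  next
    case (Suc n)
    define next_letters where "next_letters w = {x. w @ [x] \<in> W (Suc (Suc n))}" for w
    have next_sub: "next_letters w \<subseteq> letters d" for w
      using letter by (auto simp: next_letters_def W_def)
    have le: "card (next_letters w) \<le> d - 1" for w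
    proof -
      have "\<not> (1 \<in> next_letters w \<and> 0 \<in> next_letters w)"
      proof
        assume "1 \<in> next_letters w \<and> 0 \<in> next_letters w"
        then obtain y y' where y: "y \<in> C" "y' \<in> C"
          and eq: "map y [0..<Suc n] = w" "y (Suc n) = 1" "map y' [0..<Suc n] = w" "y' (Suc n) = 0"
          by (auto simp: next_letters_def W_def)
        from eq have "y' i = y i" if "i < Suc n" for i
          using that by (metis add_0 nth_map_upt minus_nat.diff_0)
        from sep[OF _ y this eq(2)] eq(4) show False by simp
      qed
      moreover have "0 \<in> letters d" "1 \<in> letters d" using \<open>d \<ge> 2\<close> by (auto simp: letters_def)
      ultimately obtain x where "x \<in> letters d" "x \<notin> next_letters w" by blast
      then have "next_letters w \<subseteq> letters d - {x}" using next_sub by blast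
      then have "card (next_letters w) \<le> card (letters d - {x})"
        by (intro card_mono) (simp_all add: finite_letters)
      then show ?thesis using \<open>x \<in> letters d\<close> by (simp add: card_letters finite_letters)
    qed
    have "W (Suc (Suc n)) \<subseteq> (\<Union>w\<in>W (Suc n). (\<lambda>x. w @ [x]) ` next_letters w)"
      by (auto simp: W_def next_letters_def)
    then have "card (W (Suc (Suc n))) \<le> card (\<Union>w\<in>W (Suc n). (\<lambda>x. w @ [x]) ` next_letters w)"
      by (intro card_mono finite_UN_I finW finite_imageI finite_subset[OF next_sub finite_letters])
    also have "\<dots> \<le> (\<Sum>w\<in>W (Suc n). card ((\<lambda>x. w @ [x]) ` next_letters w))"
      by (rule card_UN_le[OF finW])
    also have "\<dots> \<le> (\<Sum>w\<in>W (Suc n). d - 1)"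
      by (intro sum_mono order_trans[OF card_image_le le] finite_subset[OF next_sub finite_letters])
    also have "\<dots> \<le> (d * (d - 1) ^ n) * (d - 1)"
      using Suc by (simp add: mult_right_mono)
    finally show ?case by (simp add: ac_simps)
  qed
  have bound: "prob C \<le> ((real d - 1) / d) ^ n" for n
  proof -
    let ?c = "\<lambda>w. {\<xi> \<in> tree_boundary d. \<forall>i<Suc n. \<xi> i = w ! i}"
    have w: "w ! i \<in> letters d" if "w \<in> W (Suc n)" "i < Suc n" for w i
      using that letter by (auto simp: W_def simp del: upt_Suc)
    have "C \<subseteq> (\<Union>w\<in>W (Suc n). ?c w)"
      using C by (auto simp: W_def simp del: upt_Suc)
    then have "prob C \<le> prob (\<Union>w\<in>W (Suc n). ?c w)"
      by (intro finite_measure_mono sets.finite_UN finW cylinder_meas)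
    also have "\<dots> \<le> (\<Sum>w\<in>W (Suc n). prob (?c w))"
      by (rule finite_measure_subadditive_finite[OF finW]) (rule image_subsetI, rule cylinder_meas)
    also have "\<dots> = (\<Sum>w\<in>W (Suc n). (1 / d) ^ Suc n)"
      by (intro sum.cong refl measure_cylinder w) (use \<open>d \<ge> 2\<close> in auto)
    also have "\<dots> = card (W (Suc n)) * (1 / d) ^ Suc n" by simp
    also have "\<dots> \<le> (d * (d - 1) ^ n) * (1 / d) ^ Suc n"
      using card_W[of n] by (intro mult_right_mono) (simp_all flip: of_nat_mult of_nat_power)
    \<comment> \<open>The factor \<open>d\<close> of the free first letter cancels one of the n+1
      factors 1/d.\<close>
    also have "\<dots> = ((real d - 1) / d) ^ n"
      using \<open>d \<ge> 2\<close> by (simp add: power_divide of_nat_diff)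
    finally show ?thesis .
  qed
  have "(\<lambda>n. ((real d - 1) / d) ^ n) \<longlonglongrightarrow> 0"
    by (rule LIMSEQ_realpow_zero) (use \<open>d \<ge> 2\<close> in \<open>auto simp: field_simps\<close>)
  then have "prob C \<le> 0"
    by (rule LIMSEQ_le_const) (use bound in blast)
  then have "prob C = 0" using measure_nonneg[of "bernoulli_measure d" C] by linarith
  then show ?thesis using assms(2) by (simp add: null_sets_def emeasure_eq_measure)
qed

section \<open>Measurability of maps on the boundary\<close>

lemma bernoulli_measurableI:
  assumes "\<And>\<xi>. \<xi> \<in> tree_boundary d \<Longrightarrow> f \<xi> \<in> tree_boundary d"
    and "\<And>n c. {\<xi> \<in> tree_boundary d. f \<xi> n = c} \<in> sets (bernoulli_measure d)"
  shows "f \<in> bernoulli_measure d \<rightarrow>\<^sub>M bernoulli_measure d"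
proof -
  have "(\<lambda>\<xi>. f \<xi> n) \<in> bernoulli_measure d \<rightarrow>\<^sub>M uniform_count_measure (letters d)" for n
  proof -
    have "(\<lambda>\<xi>. f \<xi> n) \<in> bernoulli_measure d \<rightarrow>\<^sub>M count_space (letters d)"
      unfolding measurable_count_space_eq2[OF finite_letters]
    proof (intro conjI ballI)
      fix c
      have "(\<lambda>\<xi>. f \<xi> n) -` {c} \<inter> space (bernoulli_measure d) = {\<xi> \<in> tree_boundary d. f \<xi> n = c}"
        by (auto simp: space_bernoulli)
      then show "(\<lambda>\<xi>. f \<xi> n) -` {c} \<inter> space (bernoulli_measure d) \<in> sets (bernoulli_measure d)"
        using assms(2) by simp
    qed (use assms(1) in \<open>auto simp: space_bernoulli\<close>)
    moreover have "sets (uniform_count_measure (letters d)) = sets (count_space (letters d))"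
      by (simp add: sets_uniform_count_measure)
    ultimately show ?thesis using measurable_cong_sets[OF refl] by blast
  qed
  then have "(\<lambda>\<xi> n. f \<xi> n) \<in> bernoulli_measure d \<rightarrow>\<^sub>M PiM UNIV (\<lambda>_. uniform_count_measure (letters d))"
    by (intro measurable_PiM_single')
      (use assms(1) in \<open>auto simp: space_bernoulli space_uniform_count_measure\<close>)
  then show ?thesis by (simp add: bernoulli_measure_def)
qed

text \<open>Equality of sequences is agreement in every coordinate, and each coordinate takes
  finitely many values; this gives a countable intersection of finite unions.\<close>

lemma bernoulli_eq_meas:
  assumes f: "f \<in> bernoulli_measure d \<rightarrow>\<^sub>M bernoulli_measure d"
    and g: "g \<in> bernoulli_measure d \<rightarrow>\<^sub>M bernoulli_measure d"
  shows "{\<xi> \<in> space (bernoulli_measure d). f \<xi> = g \<xi>} \<in> sets (bernoulli_measure d)"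
proof -
  have coord: "{\<xi> \<in> space (bernoulli_measure d). h \<xi> n = c} \<in> sets (bernoulli_measure d)"
    if "h \<in> bernoulli_measure d \<rightarrow>\<^sub>M bernoulli_measure d" for h n c
  proof -
    have "{\<xi> \<in> space (bernoulli_measure d). h \<xi> n = c}
        = h -` {\<xi> \<in> tree_boundary d. \<xi> n = c} \<inter> space (bernoulli_measure d)"
      using measurable_space[OF that] by (auto simp: space_bernoulli)
    then show ?thesis using measurable_sets[OF that bernoulli_coord_meas] by simp
  qed
  have f_letter: "f \<xi> n \<in> letters d" if "\<xi> \<in> space (bernoulli_measure d)" for \<xi> n
    using measurable_space[OF f that] by (simp add: space_bernoulli Pi_iff)
  have "{\<xi> \<in> space (bernoulli_measure d). f \<xi> = g \<xi>} = {\<xi> \<in> space (bernoulli_measure d).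
      \<forall>n. \<exists>c\<in>letters d. f \<xi> n = c \<and> g \<xi> n = c}"
    using f_letter by (auto simp: fun_eq_iff)
  also have "\<dots> \<in> sets (bernoulli_measure d)"
    by (intro sets.sets_Collect_countable_All sets.sets_Collect_finite_Ex sets.sets_Collect_conj
        coord f g finite_letters)
  finally show ?thesis .
qed

text \<open>Letter \<open>n\<close> of the image is a function of the first n+1 letters, so its
  level sets are finite unions of cylinders.\<close>

lemma boundary_act_measurable:
  assumes "\<And>\<xi>. \<xi> \<in> tree_boundary d \<Longrightarrow> boundary_act g \<xi> \<in> tree_boundary d"
  shows "boundary_act g \<in> bernoulli_measure d \<rightarrow>\<^sub>M bernoulli_measure d"
proof (rule bernoulli_measurableI)
  fix n c
  let ?L = "{w. set w \<subseteq> letters d \<and> length w = Suc n \<and> g w ! n = c}"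
  have "finite {w. set w \<subseteq> letters d \<and> length w = Suc n}"
    by (rule finite_lists_length_eq[OF finite_letters])
  then have fin: "finite ?L" by (rule rev_finite_subset) auto
  have "{\<xi> \<in> tree_boundary d. boundary_act g \<xi> n = c} = (\<Union>w\<in>?L. {\<xi> \<in> tree_boundary d. \<forall>i<Suc n. \<xi> i = w ! i})"
  proof (rule equalityI; rule subsetI)
    fix \<xi> assume "\<xi> \<in> {\<xi> \<in> tree_boundary d. boundary_act g \<xi> n = c}"
    then show "\<xi> \<in> (\<Union>w\<in>?L. {\<xi> \<in> tree_boundary d. \<forall>i<Suc n. \<xi> i = w ! i})"
      by (intro UN_I[of "map \<xi> [0..<Suc n]"]) (auto simp: boundary_act_def simp del: upt_Suc)
  next
    fix \<xi> assume "\<xi> \<in> (\<Union>w\<in>?L. {\<xi> \<in> tree_boundary d. \<forall>i<Suc n. \<xi> i = w ! i})"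
    then obtain w where w: "w \<in> ?L" "\<xi> \<in> tree_boundary d" "\<forall>i<Suc n. \<xi> i = w ! i" by blast
    then have "map \<xi> [0..<Suc n] = w"
      by (intro nth_equalityI) (auto simp del: upt_Suc)
    then show "\<xi> \<in> {\<xi> \<in> tree_boundary d. boundary_act g \<xi> n = c}"
      using w by (auto simp: boundary_act_def simp del: upt_Suc)
  qed
  then show "{\<xi> \<in> tree_boundary d. boundary_act g \<xi> n = c} \<in> sets (bernoulli_measure d)"
    by (simp only:) (intro sets.finite_UN fin cylinder_meas)
qed (rule assms)

section \<open>Tree automorphisms\<close>

lemma tree_aut_carrier:
  "g \<in> carrier (tree_aut d) \<longleftrightarrow> g \<in> Bij (words d) \<and> g [] = [] \<and>
     (\<forall>u\<in>words d. \<forall>v\<in>words d. (\<exists>x. v = u @ [x]) \<longleftrightarrow> (\<exists>x. g v = g u @ [x]))"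
  by (simp add: tree_aut_def)

lemma tree_aut_extend_iff:
  assumes "g \<in> carrier (tree_aut d)" "u \<in> words d" "v \<in> words d"
  shows "(\<exists>x. v = u @ [x]) \<longleftrightarrow> (\<exists>x. g v = g u @ [x])"
  using assms unfolding tree_aut_carrier by blast

lemma tree_aut_Nil: "g \<in> carrier (tree_aut d) \<Longrightarrow> g [] = []"
  by (simp add: tree_aut_carrier)

lemma tree_aut_words: "g \<in> carrier (tree_aut d) \<Longrightarrow> w \<in> words d \<Longrightarrow> g w \<in> words d"
  by (auto simp: tree_aut_carrier dest: Bij_imp_funcset)

lemma tree_aut_mult:
  assumes "g \<in> carrier (tree_aut d)" "h \<in> carrier (tree_aut d)"
  shows "g \<otimes>\<^bsub>tree_aut d\<^esub> h = compose (words d) g h"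
  using assms by (simp add: tree_aut_carrier) (simp add: tree_aut_def BijGroup_def)

lemma tree_aut_one: "\<one>\<^bsub>tree_aut d\<^esub> = (\<lambda>w\<in>words d. w)"
  by (simp add: tree_aut_def BijGroup_def)

lemma subgroup_tree_aut: "subgroup (carrier (tree_aut d)) (BijGroup (words d))"
proof (rule subgroup.intro)
  show "carrier (tree_aut d) \<subseteq> carrier (BijGroup (words d))"
    by (auto simp: tree_aut_carrier BijGroup_def)
  show "\<one>\<^bsub>BijGroup (words d)\<^esub> \<in> carrier (tree_aut d)"
    using id_Bij by (simp add: tree_aut_carrier BijGroup_def)
next
  fix g h assume g: "g \<in> carrier (tree_aut d)" and h: "h \<in> carrier (tree_aut d)"
  then have "g \<otimes>\<^bsub>BijGroup (words d)\<^esub> h = compose (words d) g h"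
    by (simp add: tree_aut_carrier BijGroup_def)
  moreover have "compose (words d) g h \<in> Bij (words d)"
    using g h by (simp add: tree_aut_carrier compose_Bij)
  moreover have "(\<exists>x. v = u @ [x]) \<longleftrightarrow> (\<exists>x. g (h v) = g (h u) @ [x])" if "u \<in> words d" "v \<in> words d" for u v
    by (rule trans[OF tree_aut_extend_iff[OF h that]
          tree_aut_extend_iff[OF g tree_aut_words[OF h that(1)] tree_aut_words[OF h that(2)]]])
  ultimately show "g \<otimes>\<^bsub>BijGroup (words d)\<^esub> h \<in> carrier (tree_aut d)"
    using g h by (simp add: tree_aut_carrier compose_def)
next
  fix g assume g: "g \<in> carrier (tree_aut d)"
  then have B: "g \<in> Bij (words d)" by (simp add: tree_aut_carrier)
  then have inj: "inj_on g (words d)" and im: "g ` words d = words d"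
    by (auto simp: Bij_def bij_betw_def)
  let ?i = "inv_into (words d) g"
  have i: "?i w \<in> words d" "g (?i w) = w" if "w \<in> words d" for w
  proof -
    have "w \<in> g ` words d" using that im by simp
    then show "?i w \<in> words d" "g (?i w) = w" by (rule inv_into_into, rule f_inv_into_f)
  qed
  have "?i [] = []"
    using inv_into_f_f[OF inj, of "[]"] tree_aut_Nil[OF g] by simp
  moreover have "(\<exists>x. v = u @ [x]) \<longleftrightarrow> (\<exists>x. ?i v = ?i u @ [x])" if "u \<in> words d" "v \<in> words d" for u v
    using tree_aut_extend_iff[OF g i(1)[OF that(1)] i(1)[OF that(2)]]
    by (simp only: i(2)[OF that(1)] i(2)[OF that(2)])
  ultimately show "inv\<^bsub>BijGroup (words d)\<^esub> g \<in> carrier (tree_aut d)"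
    using restrict_inv_into_Bij[OF B] by (simp add: inv_BijGroup[OF B] tree_aut_carrier)
qed

lemma group_tree_aut: "group (tree_aut d)"
proof -
  have "tree_aut d = (BijGroup (words d)) \<lparr>carrier := carrier (tree_aut d)\<rparr>"
    by (simp add: tree_aut_def)
  then show ?thesis using subgroup.subgroup_is_group[OF subgroup_tree_aut group_BijGroup] by metis
qed

text \<open>A child of \<open>u\<close> is a word one letter longer with prefix \<open>u\<close>. A
  map that preserves lengths and commutes with \<open>take\<close> respects this relation, and the
  inverse \<open>h\<close> yields the converse direction.\<close>

lemma tree_autI:
  assumes "g \<in> extensional (words d)"
    and g: "\<And>w. w \<in> words d \<Longrightarrow> g w \<in> words d" and h: "\<And>w. w \<in> words d \<Longrightarrow> h w \<in> words d"
    and hg: "\<And>w. w \<in> words d \<Longrightarrow> h (g w) = w" and gh: "\<And>w. w \<in> words d \<Longrightarrow> g (h w) = w"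
    and len: "\<And>w. w \<in> words d \<Longrightarrow> length (g w) = length w"
    and take: "\<And>w k. w \<in> words d \<Longrightarrow> g (take k w) = take k (g w)"
  shows "g \<in> carrier (tree_aut d)"
proof -
  have "bij_betw g (words d) (words d)"
    by (rule bij_betw_byWitness[where f' = h]) (use g h hg gh in auto)
  moreover have "g [] = []" using len[of "[]"] by simp
  moreover have "(\<exists>x. v = u @ [x]) \<longleftrightarrow> (\<exists>x. g v = g u @ [x])" if u: "u \<in> words d" and v: "v \<in> words d" for u v
  proof -
    have snoc: "(\<exists>x. b = a @ [x]) \<longleftrightarrow> length b = Suc (length a) \<and> take (length a) b = a" for a b :: "int list"
    proof
      assume r: "length b = Suc (length a) \<and> take (length a) b = a"
      then have "b = take (length a) b @ [b ! length a]"
        by (metis lessI take_Suc_conv_app_nth take_all_iff order_refl)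
      then show "\<exists>x. b = a @ [x]" using r by metis
    qed auto
    have "take (length u) v = u \<longleftrightarrow> g (take (length u) v) = g u"
      using hg u v by (metis in_listsI in_listsD in_set_takeD)
    then show ?thesis unfolding snoc using len[OF u] len[OF v] take[OF v, of "length u"] by simp
  qed
  ultimately show ?thesis using assms(1) by (auto simp: tree_aut_carrier Bij_def)
qed

lemma prefix_in_words: "\<xi> \<in> tree_boundary d \<Longrightarrow> map \<xi> [0..<n] \<in> words d"
  by (auto simp: Pi_iff)

text \<open>\<open>boundary_act\<close> reads letter \<open>n\<close> off the image of the prefix of
  length n+1. The images of successive prefixes extend one another, so the letters fit
  together.\<close>

lemma boundary_act_prefix:
  assumes g: "g \<in> carrier (tree_aut d)" and \<xi>: "\<xi> \<in> tree_boundary d"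
  shows "map (boundary_act g \<xi>) [0..<n] = g (map \<xi> [0..<n])"
proof (induction n)
  case 0
  then show ?case using g by (simp add: tree_aut_carrier)
next
  case (Suc n)
  have "\<exists>x. g (map \<xi> [0..<Suc n]) = g (map \<xi> [0..<n]) @ [x]"
    using tree_aut_extend_iff[OF g prefix_in_words[OF \<xi>, of n] prefix_in_words[OF \<xi>, of "Suc n"]]
    by simp
  then obtain x where x: "g (map \<xi> [0..<Suc n]) = g (map \<xi> [0..<n]) @ [x]" by blast
  have "length (g (map \<xi> [0..<n])) = n"
    using arg_cong[OF Suc, of length] by simp
  then have "boundary_act g \<xi> n = x" unfolding boundary_act_def x by (metis nth_append_length)
  then show ?case unfolding x Suc[symmetric] by simp
qed

lemma boundary_act_closed:
  assumes g: "g \<in> carrier (tree_aut d)" and \<xi>: "\<xi> \<in> tree_boundary d"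
  shows "boundary_act g \<xi> \<in> tree_boundary d"
proof
  fix n
  have "map (boundary_act g \<xi>) [0..<Suc n] \<in> words d"
    unfolding boundary_act_prefix[OF assms] by (rule tree_aut_words[OF g prefix_in_words[OF \<xi>]])
  then show "boundary_act g \<xi> n \<in> letters d" by auto
qed

lemma boundary_act_mult:
  assumes "g \<in> carrier (tree_aut d)" "h \<in> carrier (tree_aut d)" "\<xi> \<in> tree_boundary d"
  shows "boundary_act (g \<otimes>\<^bsub>tree_aut d\<^esub> h) \<xi> = boundary_act g (boundary_act h \<xi>)"
proof
  fix n
  show "boundary_act (g \<otimes>\<^bsub>tree_aut d\<^esub> h) \<xi> n = boundary_act g (boundary_act h \<xi>) n"
    unfolding boundary_act_def[of g] boundary_act_prefix[OF assms(2,3)]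
    using prefix_in_words[OF assms(3), of "Suc n"]
    by (simp add: boundary_act_def tree_aut_mult[OF assms(1,2)] compose_def del: upt_Suc)
qed

lemma boundary_act_one:
  assumes "\<xi> \<in> tree_boundary d" shows "boundary_act \<one>\<^bsub>tree_aut d\<^esub> \<xi> = \<xi>"
proof
  fix n show "boundary_act \<one>\<^bsub>tree_aut d\<^esub> \<xi> n = \<xi> n"
    using prefix_in_words[OF assms, of "Suc n"]
    by (simp add: boundary_act_def tree_aut_one del: upt_Suc)
qed

section \<open>The spinal generators as letter shifts\<close>

text \<open>
  Both kinds of generators letter_shift the letters at positions selected by a predicate \<open>\<alpha>\<close> on the
  preceding letters: position \<open>0\<close> for the rooted generators, the position after
  \<open>(d - 1)\<^sup>r 0\<close> for the spinal ones.
\<close>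

definition letter_shift :: "nat \<Rightarrow> ((nat \<Rightarrow> int) \<Rightarrow> nat \<Rightarrow> bool) \<Rightarrow> (nat \<Rightarrow> int) \<Rightarrow> int list \<Rightarrow> int list" where
  "letter_shift d \<alpha> \<kappa> = (\<lambda>w\<in>words d.
     map (\<lambda>i. if \<alpha> ((!) w) i then (w ! i + \<kappa> i) mod int d else w ! i) [0..<length w])"

lemma shift_length [simp]: "w \<in> words d \<Longrightarrow> length (letter_shift d \<alpha> \<kappa> w) = length w"
  by (simp add: letter_shift_def)

lemma shift_nth: "w \<in> words d \<Longrightarrow> i < length w \<Longrightarrow>
    letter_shift d \<alpha> \<kappa> w ! i = (if \<alpha> ((!) w) i then (w ! i + \<kappa> i) mod int d else w ! i)"
  by (simp add: letter_shift_def)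

lemma shift_words:
  assumes "d \<ge> 1" "w \<in> words d" shows "letter_shift d \<alpha> \<kappa> w \<in> words d"
proof -
  have "letter_shift d \<alpha> \<kappa> w ! i \<in> letters d" if "i < length w" for i
    using assms that by (simp add: shift_nth letters_def in_lists_conv_set)
  then show ?thesis using assms by (metis in_lists_conv_set in_set_conv_nth shift_length)
qed

text \<open>\<open>local\<close> makes a shift compatible with prefixes. \<open>stable\<close> says
  that a shift does not disturb the selection of its own positions, so that shifts compose by adding
  the amounts and are inverted by negating them.\<close>

locale prefix_predicate =
  fixes \<alpha> :: "(nat \<Rightarrow> int) \<Rightarrow> nat \<Rightarrow> bool"
  assumes local: "\<And>y y' i. (\<And>j. j < i \<Longrightarrow> y' j = y j) \<Longrightarrow> \<alpha> y' i = \<alpha> y i"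
    and stable: "\<And>y y' i. (\<And>j. \<not> \<alpha> y j \<Longrightarrow> y' j = y j) \<Longrightarrow> \<alpha> y' i = \<alpha> y i"
begin

lemma shift_predicate:
  assumes w: "w \<in> words d" and "i < length w"
  shows "\<alpha> ((!) (letter_shift d \<alpha> \<kappa> w)) i = \<alpha> ((!) w) i"
proof -
  \<comment> \<open>Past the end of a list \<open>!\<close> is unspecified. There \<open>y'\<close>
    copies \<open>w\<close>, so that \<open>stable\<close> applies; \<open>local\<close> leads back
    to the shifted list, as \<open>i\<close> is within range.\<close>
  define y' where "y' j = (if j < length w then letter_shift d \<alpha> \<kappa> w ! j else w ! j)" for j
  have "\<alpha> ((!) (letter_shift d \<alpha> \<kappa> w)) i = \<alpha> y' i"
    by (rule local) (use assms in \<open>simp add: y'_def\<close>)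
  also have "\<dots> = \<alpha> ((!) w) i"
    by (rule stable) (use w in \<open>simp add: y'_def shift_nth\<close>)
  finally show ?thesis .
qed

lemma shift_shift:
  assumes "d \<ge> 1" and w: "w \<in> words d"
  shows "letter_shift d \<alpha> \<kappa>' (letter_shift d \<alpha> \<kappa> w) = letter_shift d \<alpha> (\<lambda>i. \<kappa> i + \<kappa>' i) w"
proof (rule nth_equalityI)
  fix i assume "i < length (letter_shift d \<alpha> \<kappa>' (letter_shift d \<alpha> \<kappa> w))"
  then have "i < length w" using shift_words[OF assms] w by simp
  then show "letter_shift d \<alpha> \<kappa>' (letter_shift d \<alpha> \<kappa> w) ! i = letter_shift d \<alpha> (\<lambda>i. \<kappa> i + \<kappa>' i) w ! i"
    using shift_words[OF assms] w
    by (simp add: shift_nth shift_predicate mod_add_left_eq add.assoc)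
qed (use shift_words[OF assms] w in simp)

lemma shift_zero: "w \<in> words d \<Longrightarrow> letter_shift d \<alpha> (\<lambda>_. 0) w = w"
proof (rule nth_equalityI)
  assume w: "w \<in> words d"
  fix i assume "i < length (letter_shift d \<alpha> (\<lambda>_. 0) w)"
  then have i: "i < length w" using w by simp
  then have "w ! i \<in> letters d" using w nth_mem by blast
  then show "letter_shift d \<alpha> (\<lambda>_. 0) w ! i = w ! i" using w i by (simp add: shift_nth letters_def)
qed simp

lemma shift_tree_aut:
  assumes "d \<ge> 1" shows "letter_shift d \<alpha> \<kappa> \<in> carrier (tree_aut d)"
proof (rule tree_autI[where h = "letter_shift d \<alpha> (\<lambda>i. - \<kappa> i)"])
  fix w k assume w: "w \<in> words d"
  show "letter_shift d \<alpha> \<kappa> w \<in> words d" "letter_shift d \<alpha> (\<lambda>i. - \<kappa> i) w \<in> words d"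
    by (rule shift_words[OF assms w])+
  show "length (letter_shift d \<alpha> \<kappa> w) = length w" using w by (rule shift_length)
  show "letter_shift d \<alpha> (\<lambda>i. - \<kappa> i) (letter_shift d \<alpha> \<kappa> w) = w" "letter_shift d \<alpha> \<kappa> (letter_shift d \<alpha> (\<lambda>i. - \<kappa> i) w) = w"
    using shift_zero[OF w] by (simp_all add: shift_shift[OF assms w])
  have tw: "take k w \<in> words d" using w by (auto dest: in_set_takeD)
  show "letter_shift d \<alpha> \<kappa> (take k w) = take k (letter_shift d \<alpha> \<kappa> w)"
  proof (rule nth_equalityI)
    fix i assume "i < length (letter_shift d \<alpha> \<kappa> (take k w))"
    then have i: "i < k" "i < length w" using tw by auto
    have "\<alpha> ((!) (take k w)) i = \<alpha> ((!) w) i" by (rule local) (use i in simp)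
    then show "letter_shift d \<alpha> \<kappa> (take k w) ! i = take k (letter_shift d \<alpha> \<kappa> w) ! i"
      using i w tw by (simp add: shift_nth)
  qed (use w tw in simp)
qed (simp add: letter_shift_def)

lemma boundary_act_shift:
  assumes "\<xi> \<in> tree_boundary d"
  shows "boundary_act (letter_shift d \<alpha> \<kappa>) \<xi> i = (if \<alpha> \<xi> i then (\<xi> i + \<kappa> i) mod int d else \<xi> i)"
proof -
  have "\<alpha> ((!) (map \<xi> [0..<Suc i])) i = \<alpha> \<xi> i"
    by (rule local) (simp del: upt_Suc)
  then show ?thesis
    using prefix_in_words[OF assms, of "Suc i"]
    by (simp add: boundary_act_def shift_nth del: upt_Suc)
qed

end

section \<open>The rooted and the spinal selection of positions\<close>

definition rooted :: "(nat \<Rightarrow> int) \<Rightarrow> nat \<Rightarrow> bool" where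
  "rooted y i \<longleftrightarrow> i = 0"

definition spinal :: "nat \<Rightarrow> (nat \<Rightarrow> int) \<Rightarrow> nat \<Rightarrow> bool" where
  "spinal d y i \<longleftrightarrow> (\<exists>r. i = Suc r \<and> (\<forall>j<r. y j = int d - 1) \<and> y r = 0)"

interpretation rooted: prefix_predicate rooted
  by unfold_locales (simp_all add: rooted_def)

lemma spinal_unique:
  assumes "d \<ge> 2" "spinal d y i" "spinal d y j" shows "i = j"
proof -
  from assms obtain r s where "i = Suc r" "\<forall>k<r. y k = int d - 1" "y r = 0"
    "j = Suc s" "\<forall>k<s. y k = int d - 1" "y s = 0"
    unfolding spinal_def by blast
  then show ?thesis using \<open>d \<ge> 2\<close> by (cases r s rule: linorder_cases) force+
qed

text \<open>At most one position is selected, and its selection depends only on the letters before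
  it, which the shift leaves alone.\<close>

lemma prefix_predicate_spinal:
  assumes "d \<ge> 2" shows "prefix_predicate (spinal d)"
proof
  fix y y' :: "nat \<Rightarrow> int" and i
  assume "\<And>j. j < i \<Longrightarrow> y' j = y j"
  then show "spinal d y' i = spinal d y i" unfolding spinal_def by auto
next
  fix y y' :: "nat \<Rightarrow> int" and i
  assume agree: "\<And>j. \<not> spinal d y j \<Longrightarrow> y' j = y j"
  show "spinal d y' i = spinal d y i"
  proof (cases "\<exists>k. spinal d y k")
    case True
    then obtain r where r: "spinal d y (Suc r)" "\<forall>j<r. y j = int d - 1" "y r = 0"
      unfolding spinal_def by blast
    then have "y' j = y j" if "j \<noteq> Suc r" for j
      using agree spinal_unique[OF assms] that by blast
    then have "spinal d y' (Suc r)" using r unfolding spinal_def by auto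
    then show ?thesis using r(1) spinal_unique[OF assms] by blast
  next
    case False
    then have "y' = y" using agree by blast
    then show ?thesis by simp
  qed
qed

definition rot :: "nat \<Rightarrow> int \<Rightarrow> int list \<Rightarrow> int list" where
  "rot d k = letter_shift d rooted (\<lambda>_. k)"

lemma rooted_gen_eq_rot: "rooted_gen d = rot d 1"
proof (rule extensionalityI[of _ "words d"])
  fix w assume w: "w \<in> words d"
  show "rooted_gen d w = rot d 1 w"
  proof (rule nth_equalityI)
    show "length (rooted_gen d w) = length (rot d 1 w)"
      using w by (cases w) (auto simp: rooted_gen_def rot_def)
    fix i assume "i < length (rooted_gen d w)"
    then have "i < length w" using w by (cases w) (auto simp: rooted_gen_def)
    then show "rooted_gen d w ! i = rot d 1 w ! i"
      using w by (cases w; cases i) (auto simp: rooted_gen_def rot_def shift_nth rooted_def)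
  qed
qed (auto simp: rooted_gen_def rot_def letter_shift_def)

lemma rot_mult:
  assumes "d \<ge> 1" shows "rot d k \<otimes>\<^bsub>tree_aut d\<^esub> rot d l = rot d (k + l)"
proof -
  have "rot d k \<otimes>\<^bsub>tree_aut d\<^esub> rot d l = compose (words d) (rot d k) (rot d l)"
    unfolding rot_def by (intro tree_aut_mult rooted.shift_tree_aut assms)
  also have "\<dots> = rot d (k + l)"
  proof (rule extensionalityI[of _ "words d"])
    fix w assume "w \<in> words d"
    then show "compose (words d) (rot d k) (rot d l) w = rot d (k + l) w"
      by (simp add: compose_def rot_def rooted.shift_shift[OF assms] add.commute)
  qed (auto simp: rot_def letter_shift_def)
  finally show ?thesis .
qed

lemma rot_zero: "rot d 0 = \<one>\<^bsub>tree_aut d\<^esub>"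
proof (rule extensionalityI[of _ "words d"])
  fix w assume "w \<in> words d"
  then show "rot d 0 w = \<one>\<^bsub>tree_aut d\<^esub> w" by (simp add: rot_def rooted.shift_zero tree_aut_one)
qed (auto simp: rot_def letter_shift_def tree_aut_one)

lemma rot_mod: "rot d (k mod int d) = rot d k"
  unfolding rot_def letter_shift_def by (simp add: mod_add_right_eq cong: if_cong)

lemma rot_tree_aut: "d \<ge> 1 \<Longrightarrow> rot d k \<in> carrier (tree_aut d)"
  unfolding rot_def by (rule rooted.shift_tree_aut)

lemma carrier_group_A:
  assumes "d \<ge> 1" shows "carrier (group_A d) = range (rot d)"
proof -
  interpret group "tree_aut d" by (rule group_tree_aut)
  have "carrier (tree_aut d) \<inter> {rot d 1} = {rot d 1}" using rot_tree_aut[OF assms] by auto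
  then have A: "carrier (group_A d) = generate (tree_aut d) {rot d 1}"
    unfolding group_A_def by (simp add: carrier_subgroup_generated rooted_gen_eq_rot)
  have "g \<in> range (rot d)" if "g \<in> generate (tree_aut d) {rot d 1}" for g
    using that
  proof induction
    case one
    then show ?case unfolding rot_zero[symmetric] by blast
  next
    case (inv h)
    have "inv\<^bsub>tree_aut d\<^esub> (rot d 1) = rot d (- 1)"
      by (rule inv_equality) (use rot_tree_aut[OF assms] in \<open>simp_all add: rot_mult[OF assms] rot_zero\<close>)
    then show ?case using inv by auto
  next
    case (eng g h)
    then show ?case by (auto simp: rot_mult[OF assms])
  qed auto
  moreover have nat: "rot d (int n) \<in> generate (tree_aut d) {rot d 1}" for n
  proof (induction n)
    case 0
    then show ?case by (simp add: rot_zero generate.one)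
  next
    case (Suc n)
    have "rot d 1 \<otimes>\<^bsub>tree_aut d\<^esub> rot d (int n) \<in> generate (tree_aut d) {rot d 1}"
      by (intro generate.eng generate.incl Suc) simp
    then show ?case by (simp add: rot_mult[OF assms])
  qed
  \<comment> \<open>Modulo \<open>d\<close> every exponent is nonnegative, so the powers obtained by
    induction suffice.\<close>
  moreover have "rot d k \<in> generate (tree_aut d) {rot d 1}" for k
    using nat[of "nat (k mod int d)"] assms by (simp add: rot_mod)
  ultimately show ?thesis unfolding A by blast
qed

lemma finite_group_B: "d \<ge> 1 \<Longrightarrow> finite (carrier (group_B d m))"
  by (simp add: group_B_def carrier_integer_mod_group finite_PiE)

text \<open>The number \<open>r\<close> found by \<open>takeWhile\<close> is the only candidate for
  a prefix (d-1)^r 0. Rotating the first letter of the remaining word is a shift at position r+1,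
  hence \<open>\<kappa>\<close> is read at \<open>Suc r\<close>.\<close>

lemma spinal_elt_eq_shift:
  assumes "d \<ge> 2" and \<omega>: "\<And>r. \<omega> r b = rot d (\<kappa> (Suc r))"
  shows "spinal_elt d \<omega> b = letter_shift d (spinal d) \<kappa>"
proof (rule extensionalityI[of _ "words d"])
  fix w assume w: "w \<in> words d"
  define r where "r = length (takeWhile (\<lambda>x. x = int d - 1) w)"
  have below: "w ! j = int d - 1" if "j < r" for j
    using that nth_mem[of j "takeWhile (\<lambda>x. x = int d - 1) w"] set_takeWhileD[of "w ! j" "\<lambda>x. x = int d - 1" w]
    by (simp add: r_def takeWhile_nth)
  have active: "spinal d ((!) w) i \<longleftrightarrow> i = Suc r \<and> w ! r = 0" if "i < length w" for i
  proof
    assume "spinal d ((!) w) i"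
    then obtain s where s: "i = Suc s" "\<forall>j<s. w ! j = int d - 1" "w ! s = 0"
      unfolding spinal_def by blast
    then have "takeWhile (\<lambda>x. x = int d - 1) w = take s w"
      using \<open>d \<ge> 2\<close> by (intro takeWhile_eq_take_P_nth) auto
    then have "r = s" unfolding r_def using that s by simp
    then show "i = Suc r \<and> w ! r = 0" using s by simp
  next
    assume "i = Suc r \<and> w ! r = 0"
    then show "spinal d ((!) w) i" unfolding spinal_def using below by blast
  qed
  show "spinal_elt d \<omega> b w = letter_shift d (spinal d) \<kappa> w"
  proof (cases "r < length w \<and> w ! r = 0")
    case True
    have dw: "drop (Suc r) w \<in> words d" using w by (auto dest: in_set_dropD)
    have e: "spinal_elt d \<omega> b w = take (Suc r) w @ rot d (\<kappa> (Suc r)) (drop (Suc r) w)"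
      using True w \<omega> by (simp add: spinal_elt_def r_def Let_def)
    have lt: "length (take (Suc r) w) = Suc r" using True by simp
    have "length (rot d (\<kappa> (Suc r)) (drop (Suc r) w)) = length w - Suc r"
      using dw by (simp add: rot_def)
    then have len: "length (spinal_elt d \<omega> b w) = length w"
      unfolding e length_append lt using True by arith
    show ?thesis
    proof (rule nth_equalityI)
      show "length (spinal_elt d \<omega> b w) = length (letter_shift d (spinal d) \<kappa> w)"
        using len w by simp
      fix i assume "i < length (spinal_elt d \<omega> b w)"
      then have i: "i < length w" using len by simp
      show "spinal_elt d \<omega> b w ! i = letter_shift d (spinal d) \<kappa> w ! i"
      proof (cases "i < Suc r")
        case True
        then show ?thesis unfolding e nth_append lt using i w by (simp add: shift_nth active)
      next
        case False
        then have "i - Suc r < length (drop (Suc r) w)" using i by simp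
        then show ?thesis
          unfolding e nth_append lt using i w dw False True
          by (auto simp: shift_nth active rot_def rooted_def \<open>r < length w \<and> w ! r = 0\<close>)
      qed
    qed
  next
    case False
    then have "spinal_elt d \<omega> b w = w" using w by (auto simp: spinal_elt_def r_def Let_def)
    also have "w = letter_shift d (spinal d) \<kappa> w"
      by (rule nth_equalityI) (use w False in \<open>auto simp: shift_nth active\<close>)
    finally show ?thesis .
  qed
qed (auto simp: spinal_elt_def letter_shift_def)

section \<open>The Schreier graphs\<close>

context
  fixes d m :: nat and \<omega> :: "nat \<Rightarrow> (nat \<Rightarrow> int) \<Rightarrow> (int list \<Rightarrow> int list)"
  assumes d: "d \<ge> 2" and \<omega>: "\<omega> \<in> Omega d m"
begin

text \<open>This is surjectivity of \<open>\<omega> r\<close> onto A; it lets the spinal generators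
  put any letter after (d-1)^r 0.\<close>

lemma omega_image: "\<omega> r ` carrier (group_B d m) = range (rot d)"
  using \<omega> carrier_group_A[of d] d by (auto simp: Omega_def epi_def)

text \<open>Collects the exponents of all levels in one function, indexed by the position of the
  moved letter rather than by \<open>r\<close>.\<close>

lemma omega_rot:
  assumes "b \<in> carrier (group_B d m)"
  obtains \<kappa> where "\<And>r. \<omega> r b = rot d (\<kappa> (Suc r))"
proof -
  have "\<exists>k. \<omega> r b = rot d k" for r
    using assms omega_image[of r] by blast
  then obtain k where "\<And>r. \<omega> r b = rot d (k r)" by metis
  then show ?thesis by (intro that[of "\<lambda>i. k (i - 1)"]) simp
qed

interpretation spinal: prefix_predicate "spinal d"
  by (rule prefix_predicate_spinal[OF d])

lemma group_A_tree_aut: "carrier (group_A d) \<subseteq> carrier (tree_aut d)"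
  using d by (auto simp: carrier_group_A intro: rot_tree_aut)

lemma B_image_tree_aut: "B_image d m \<omega> \<subseteq> carrier (tree_aut d)"
proof
  fix g assume "g \<in> B_image d m \<omega>"
  then obtain b where b: "b \<in> carrier (group_B d m)" "g = spinal_elt d \<omega> b"
    by (auto simp: B_image_def)
  from omega_rot[OF b(1)] obtain \<kappa> where "\<And>r. \<omega> r b = rot d (\<kappa> (Suc r))" by blast
  then have "spinal_elt d \<omega> b = letter_shift d (spinal d) \<kappa>" by (rule spinal_elt_eq_shift[OF d])
  then show "g \<in> carrier (tree_aut d)"
    unfolding b using spinal.shift_tree_aut d by simp
qed

lemma spinal_gens_tree_aut: "spinal_gens d m \<omega> \<subseteq> carrier (tree_aut d)"
  using group_A_tree_aut B_image_tree_aut by (auto simp: spinal_gens_def)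

lemma finite_spinal_gens: "finite (spinal_gens d m \<omega>)"
proof -
  have "finite (carrier (group_B d m))" using d by (intro finite_group_B) simp
  \<comment> \<open>A is finite as the image of the finite group B under
    \<open>\<omega> 0\<close>.\<close>
  moreover from this have "finite (\<omega> 0 ` carrier (group_B d m))" by simp
  ultimately show ?thesis
    using carrier_group_A[of d] d omega_image[of 0] by (simp add: spinal_gens_def B_image_def)
qed

lemma mod_shift:
  assumes "y \<in> tree_boundary d" "c \<in> letters d"
  shows "(y i + (c - y i)) mod int d = c"
  using assms(2) by (simp add: letters_def)

lemma boundary_act_rot:
  assumes "y \<in> tree_boundary d"
  shows "boundary_act (rot d k) y = y(0 := (y 0 + k) mod int d)"
  unfolding rot_def by (rule ext) (simp add: rooted.boundary_act_shift[OF assms] rooted_def)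

lemma boundary_act_spinal:
  assumes "y \<in> tree_boundary d" "spinal d y (Suc r)"
  shows "boundary_act (letter_shift d (spinal d) \<kappa>) y = y(Suc r := (y (Suc r) + \<kappa> (Suc r)) mod int d)"
proof -
  have "spinal d y i \<longleftrightarrow> i = Suc r" for i using assms(2) spinal_unique[OF d] by blast
  then show ?thesis by (intro ext) (simp add: spinal.boundary_act_shift[OF assms(1)])
qed

text \<open>Rotations produce every first letter, and by \<open>omega_image\<close> the spinal
  elements produce every letter after (d-1)^r 0. The identity is missing from the generators;
  \<open>insert y\<close> makes up for it.\<close>

lemma spinal_gens_nbr:
  assumes y: "y \<in> tree_boundary d"
  shows "insert y ((\<lambda>s. boundary_act s y) ` spinal_gens d m \<omega>) = seq_nbr d y"
proof (rule equalityI; rule subsetI)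
  fix z assume "z \<in> insert y ((\<lambda>s. boundary_act s y) ` spinal_gens d m \<omega>)"
  then consider "z = y" | k where "z = boundary_act (rot d k) y"
    | b where "b \<in> carrier (group_B d m)" "z = boundary_act (spinal_elt d \<omega> b) y"
    using carrier_group_A[of d] d by (auto simp: spinal_gens_def B_image_def)
  then show "z \<in> seq_nbr d y"
  proof cases
    case 1
    then show ?thesis using seq_nbr_refl[OF y] by simp
  next
    case 2
    then show ?thesis using d by (auto simp: boundary_act_rot[OF y] seq_nbr_def letters_def)
  next
    case 3
    from omega_rot[OF 3(1)] obtain \<kappa> where "\<And>r. \<omega> r b = rot d (\<kappa> (Suc r))" by blast
    then have z: "z = boundary_act (letter_shift d (spinal d) \<kappa>) y"
      unfolding 3 using spinal_elt_eq_shift[OF d, where \<kappa> = \<kappa>] by metis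
    show ?thesis
    proof (cases "\<exists>i. spinal d y i")
      case True
      then obtain r where r: "spinal d y (Suc r)" by (auto simp: spinal_def)
      then have "\<forall>i<r. y i = int d - 1" "y r = 0" by (auto simp: spinal_def)
      moreover have "z = y(Suc r := (y (Suc r) + \<kappa> (Suc r)) mod int d)"
        unfolding z by (rule boundary_act_spinal[OF y r])
      moreover have "(y (Suc r) + \<kappa> (Suc r)) mod int d \<in> letters d" using d by (simp add: letters_def)
      ultimately show ?thesis unfolding seq_nbr_def by blast
    next
      case False
      then have "z = y" unfolding z by (intro ext) (simp add: spinal.boundary_act_shift[OF y])
      then show ?thesis using seq_nbr_refl[OF y] by simp
    qed
  qed
next
  fix z assume "z \<in> seq_nbr d y"
  then consider c where "c \<in> letters d" "z = y(0 := c)"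
    | r c where "c \<in> letters d" "z = y(Suc r := c)" "\<forall>i<r. y i = int d - 1" "y r = 0"
    unfolding seq_nbr_def by blast
  then obtain s where s: "s \<in> carrier (group_A d) \<union> B_image d m \<omega>" "z = boundary_act s y"
  proof cases
    case 1
    have "rot d (c - y 0) \<in> carrier (group_A d)" using carrier_group_A[of d] d by simp
    moreover have "z = boundary_act (rot d (c - y 0)) y"
      unfolding boundary_act_rot[OF y] mod_shift[OF y 1(1)] by (rule 1)
    ultimately show ?thesis using that by blast
  next
    case 2
    have "rot d (c - y (Suc r)) \<in> \<omega> r ` carrier (group_B d m)" unfolding omega_image by blast
    then obtain b where b: "b \<in> carrier (group_B d m)" "\<omega> r b = rot d (c - y (Suc r))" by auto
    from omega_rot[OF b(1)] obtain \<kappa> where \<kappa>: "\<And>r. \<omega> r b = rot d (\<kappa> (Suc r))" by blast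
    \<comment> \<open>The exponent of a rotation is determined only modulo \<open>d\<close>.
      Replacing \<open>\<kappa>\<close> at \<open>Suc r\<close> by the wanted exponent leaves
      \<open>\<omega> r b\<close> unchanged and lets \<open>mod_shift\<close> produce
      \<open>c\<close>.\<close>
    define \<kappa>' where "\<kappa>' = \<kappa>(Suc r := c - y (Suc r))"
    have "\<omega> r' b = rot d (\<kappa>' (Suc r'))" for r' using b \<kappa> by (simp add: \<kappa>'_def)
    then have e: "spinal_elt d \<omega> b = letter_shift d (spinal d) \<kappa>'" by (rule spinal_elt_eq_shift[OF d])
    have sp: "spinal d y (Suc r)" using 2 by (auto simp: spinal_def)
    have \<kappa>'r: "\<kappa>' (Suc r) = c - y (Suc r)" by (simp add: \<kappa>'_def)
    have "boundary_act (spinal_elt d \<omega> b) y = y(Suc r := c)"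
      unfolding e boundary_act_spinal[OF y sp] \<kappa>'r mod_shift[OF y 2(1)] by (rule refl)
    then show ?thesis using that[of "spinal_elt d \<omega> b"] b 2 by (auto simp: B_image_def)
  qed
  show "z \<in> insert y ((\<lambda>s. boundary_act s y) ` spinal_gens d m \<omega>)"
    using s boundary_act_one[OF y] by (cases "s = \<one>\<^bsub>tree_aut d\<^esub>") (auto simp: spinal_gens_def)
qed

interpretation schreier: orbit_graphs "spinal_gens d m \<omega>" boundary_act "tree_boundary d"
proof
  show "finite (spinal_gens d m \<omega>)" by (rule finite_spinal_gens)
next
  fix s y assume s: "s \<in> spinal_gens d m \<omega>" and y: "y \<in> tree_boundary d"
  show closed: "boundary_act s y \<in> tree_boundary d"
    using s y spinal_gens_tree_aut by (intro boundary_act_closed) auto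
  assume ne: "boundary_act s y \<noteq> y"
  have "boundary_act s y \<in> seq_nbr d y" using s spinal_gens_nbr[OF y] by blast
  then have "y \<in> seq_nbr d (boundary_act s y)"
    by (rule seq_nbr_sym[OF y])
  then show "\<exists>s'\<in>spinal_gens d m \<omega>. boundary_act s' (boundary_act s y) = y"
    using ne unfolding spinal_gens_nbr[OF closed, symmetric] by force
qed

lemma nbr_eq_seq_nbr: "y \<in> tree_boundary d \<Longrightarrow> schreier.nbr y = seq_nbr d y"
  by (simp add: schreier.nbr_def spinal_gens_nbr)

lemma schreier_ball: "y \<in> tree_boundary d \<Longrightarrow> nball schreier.nbr k y = nball (seq_nbr d) k y"
proof (induction k)
  case (Suc k)
  have "nball (seq_nbr d) k y \<subseteq> tree_boundary d"
    by (rule seq_ball_closed[OF Suc.prems])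
  then show ?case using Suc nbr_eq_seq_nbr by (auto simp: subset_iff)
qed simp

section \<open>Orbits under words and under the group\<close>

lemma orb_sym_step:
  assumes "y \<in> tree_boundary d" "s \<in> spinal_gens d m \<omega>" "boundary_act s z = y" "z \<in> tree_boundary d"
  shows "z \<in> schreier.orb y"
proof (cases "z = y")
  case True
  then show ?thesis using schreier.orb_refl by simp
next
  case False
  then obtain s' where "s' \<in> spinal_gens d m \<omega>" "boundary_act s' y = z"
    using schreier.T_sym[OF assms(2,4)] assms(3) by auto
  then show ?thesis using schreier.T_orb[OF schreier.orb_refl] by blast
qed

lemma orb_trans: "z \<in> schreier.orb y \<Longrightarrow> x \<in> schreier.orb z \<Longrightarrow> x \<in> schreier.orb y"
proof -
  assume "z \<in> schreier.orb y" "x \<in> schreier.orb z"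
  then obtain u v where "u \<in> lists (spinal_gens d m \<omega>)" "v \<in> lists (spinal_gens d m \<omega>)"
    "x = fold boundary_act v (fold boundary_act u y)"
    by (auto simp: schreier.orb_def)
  then have "u @ v \<in> lists (spinal_gens d m \<omega>)" "x = fold boundary_act (u @ v) y" by auto
  then show ?thesis unfolding schreier.orb_def by blast
qed

text \<open>\<open>orb\<close> is built from words without formal inverses. The inverse of a
  generator leads to a point from which that generator leads back, so \<open>orb_sym_step\<close>
  covers it. Conversely, appending a letter to a word is multiplication from the left.\<close>

lemma spinal_group_orbit:
  assumes "\<xi> \<in> tree_boundary d"
  shows "(\<lambda>g. boundary_act g \<xi>) ` spinal_group d m \<omega> = schreier.orb \<xi>"
proof (rule equalityI; rule subsetI)
  interpret tree: group "tree_aut d" by (rule group_tree_aut)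
  let ?G = "carrier (group_A d) \<union> B_image d m \<omega>"
  have G: "?G \<subseteq> carrier (tree_aut d)" using group_A_tree_aut B_image_tree_aut by blast
  have gen: "s \<in> spinal_gens d m \<omega>" if "s \<in> ?G" "s \<noteq> \<one>\<^bsub>tree_aut d\<^esub>" for s
    using that by (simp add: spinal_gens_def)
  {
    fix x assume "x \<in> (\<lambda>g. boundary_act g \<xi>) ` spinal_group d m \<omega>"
    then obtain g where g: "g \<in> generate (tree_aut d) ?G" "x = boundary_act g \<xi>"
      by (auto simp: spinal_group_def)
    \<comment> \<open>Stated for all \<open>y\<close>, since in a product the left factor acts at
      the image under the right one.\<close>
    from g(1) have "g \<in> carrier (tree_aut d) \<and> (\<forall>y\<in>tree_boundary d. boundary_act g y \<in> schreier.orb y)"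
    proof induction
      case one
      then show ?case using boundary_act_one schreier.orb_refl by auto
    next
      case (incl h)
      have "boundary_act h y \<in> schreier.orb y" if y: "y \<in> tree_boundary d" for y
        using boundary_act_one[OF y] schreier.orb_refl schreier.T_orb[OF schreier.orb_refl gen[OF incl]]
        by (cases "h = \<one>\<^bsub>tree_aut d\<^esub>") auto
      then show ?case using incl G by auto
    next
      case (inv h)
      then have h: "h \<in> carrier (tree_aut d)" using G by blast
      have "boundary_act (inv\<^bsub>tree_aut d\<^esub> h) y \<in> schreier.orb y" if y: "y \<in> tree_boundary d" for y
      proof (cases "h = \<one>\<^bsub>tree_aut d\<^esub>")
        case True
        then show ?thesis using boundary_act_one[OF y] schreier.orb_refl by simp
      next
        case False
        have "boundary_act h (boundary_act (inv\<^bsub>tree_aut d\<^esub> h) y) = y"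
          using boundary_act_mult[OF h tree.inv_closed[OF h] y] tree.r_inv[OF h] boundary_act_one[OF y]
          by simp
        then show ?thesis
          by (rule orb_sym_step[OF y gen[OF inv False]])
            (rule boundary_act_closed[OF tree.inv_closed[OF h] y])
      qed
      then show ?case using tree.inv_closed[OF h] by blast
    next
      case (eng g h)
      have "boundary_act (g \<otimes>\<^bsub>tree_aut d\<^esub> h) y \<in> schreier.orb y" if y: "y \<in> tree_boundary d" for y
        using eng boundary_act_mult[of g d h y] boundary_act_closed[of h d y] y orb_trans by auto
      then show ?case using eng by auto
    qed
    then show "x \<in> schreier.orb \<xi>" using g(2) assms by blast
  next
    fix x assume "x \<in> schreier.orb \<xi>"
    then obtain u where u: "u \<in> lists (spinal_gens d m \<omega>)" "x = fold boundary_act u \<xi>"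
      by (auto simp: schreier.orb_def)
    from u(1) have "\<exists>g\<in>generate (tree_aut d) ?G. g \<in> carrier (tree_aut d) \<and> fold boundary_act u \<xi> = boundary_act g \<xi>"
    proof (induction u rule: rev_induct)
      case Nil
      then show ?case using boundary_act_one[OF assms] generate.one by fastforce
    next
      case (snoc s u)
      then obtain g where g: "g \<in> generate (tree_aut d) ?G" "g \<in> carrier (tree_aut d)"
        "fold boundary_act u \<xi> = boundary_act g \<xi>" by auto
      have s: "s \<in> ?G" "s \<in> carrier (tree_aut d)"
        using snoc.prems spinal_gens_tree_aut by (auto simp: spinal_gens_def)
      have "fold boundary_act (u @ [s]) \<xi> = boundary_act (s \<otimes>\<^bsub>tree_aut d\<^esub> g) \<xi>"
        using g by (simp add: boundary_act_mult[OF s(2) g(2) assms])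
      moreover have "s \<otimes>\<^bsub>tree_aut d\<^esub> g \<in> generate (tree_aut d) ?G"
        by (intro generate.eng generate.incl s g)
      ultimately show ?case using tree.m_closed[OF s(2) g(2)] by blast
    qed
    then show "x \<in> (\<lambda>g. boundary_act g \<xi>) ` spinal_group d m \<omega>"
      unfolding u(2) spinal_group_def by auto
  }
qed

lemma schreier_graph_eq_ograph:
  "\<xi> \<in> tree_boundary d \<Longrightarrow> schreier_graph d m \<omega> \<xi> = schreier.ograph \<xi>"
  by (simp add: schreier_graph_def schreier.ograph_def spinal_group_orbit Let_def)

lemma iso_class_sets:
  assumes "\<xi> \<in> tree_boundary d"
  shows "{\<eta> \<in> tree_boundary d. rooted_undirected_iso (schreier_graph d m \<omega> \<eta>) \<eta> (schreier_graph d m \<omega> \<xi>) \<xi>}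
      \<in> sets (bernoulli_measure d)"
proof -
  have "{\<eta> \<in> tree_boundary d. rooted_undirected_iso (schreier_graph d m \<omega> \<eta>) \<eta> (schreier_graph d m \<omega> \<xi>) \<xi>}
      = {\<eta> \<in> tree_boundary d. rooted_undirected_iso (schreier.ograph \<eta>) \<eta> (schreier.ograph \<xi>) \<xi>}"
    by (rule Collect_cong, rule conj_cong[OF refl])
      (simp only: schreier_graph_eq_ograph schreier_graph_eq_ograph[OF assms])
  moreover have "boundary_act s \<in> bernoulli_measure d \<rightarrow>\<^sub>M bernoulli_measure d"
    if "s \<in> spinal_gens d m \<omega>" for s
    by (rule boundary_act_measurable) (rule schreier.T_closed[OF that])
  ultimately show ?thesis
    by (simp only:) (rule schreier.iso_class_measurable[OF space_bernoulli _ bernoulli_eq_meas assms])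
qed

lemma iso_imp_card_ball_eq:
  assumes "rooted_undirected_iso (schreier_graph d m \<omega> \<eta>) \<eta> (schreier_graph d m \<omega> \<xi>) \<xi>"
    and "\<eta> \<in> tree_boundary d" "\<xi> \<in> tree_boundary d"
  shows "card (nball (seq_nbr d) R \<eta>) = card (nball (seq_nbr d) R \<xi>)"
  using schreier.iso_card_ball[of \<eta> \<xi> R] assms
  by (simp add: schreier_graph_eq_ograph schreier_ball)

end

theorem theorem7p12:
  fixes d m :: nat
    and \<omega> :: "nat \<Rightarrow> (nat \<Rightarrow> int) \<Rightarrow> (int list \<Rightarrow> int list)"
  assumes "d \<ge> 3" and "m \<ge> 1" and "\<omega> \<in> Omega d m"
  shows "\<forall>\<xi>\<in>tree_boundary d.
    {\<eta> \<in> tree_boundary d. rooted_undirected_iso (schreier_graph d m \<omega> \<eta>) \<eta> (schreier_graph d m \<omega> \<xi>) \<xi>}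
      \<in> null_sets (bernoulli_measure d)"
proof
  fix \<xi> assume \<xi>: "\<xi> \<in> tree_boundary d"
  have d: "d \<ge> 2" using assms(1) by simp
  let ?C = "{\<eta> \<in> tree_boundary d. rooted_undirected_iso (schreier_graph d m \<omega> \<eta>) \<eta> (schreier_graph d m \<omega> \<xi>) \<xi>}"
  show "?C \<in> null_sets (bernoulli_measure d)"
  proof (rule null_set_if_forbidden_letters[OF d iso_class_sets[OF d assms(3) \<xi>]])
    fix y y' n
    assume n: "n \<ge> (1::nat)" and y: "y \<in> ?C" "y' \<in> ?C" and eq: "\<And>i. i < n \<Longrightarrow> y' i = y i" "y n = 1"
    show "y' n \<noteq> 0"
    proof
      assume "y' n = 0"
      have "y \<in> tree_boundary d" "y' \<in> tree_boundary d" using y by simp_all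
      from card_ball_less[OF assms(1) n this, OF eq(1) eq(2) \<open>y' n = 0\<close>]
      obtain R where "card (nball (seq_nbr d) R y) < card (nball (seq_nbr d) R y')" by blast
      moreover have "card (nball (seq_nbr d) R x) = card (nball (seq_nbr d) R \<xi>)" if "x \<in> ?C" for x
        using that \<xi> by (intro iso_imp_card_ball_eq[OF d assms(3)]) auto
      ultimately show False using y by simp
    qed
  qed
qed

end
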